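(* Let $S=\begin{pmatrix}A&B\\C&D\end{pmatrix}\in\mathrm{Sp}(d,\mathbb R)$ with $B\neq 0_d$, and let $\hat S$ be a metaplectic operator with projection $S$. Let $M,N$ be real symmetric positive-semidefinite $d\times d$ matrices with $\ker(M)=\ker(B)$ and $R(N)=R(B)$. Let $f\in L^2(\mathbb R^d)$ satisfy, for some constant $c>0$, $$|f(x)|\le c\,e^{-\pi Mx\cdot x}\ \text{ for a.e. } x\in\mathbb R^d,\qquad |\hat Sf(\xi)|\le c\,e^{-\pi N\xi\cdot\xi}\ \text{ for a.e. } \xi\in\mathbb R^d.$$ If $\lambda>1$ for some eigenvalue $\lambda$ of $MB^TNB$, then $f=0$ almost everywhere.
   Context: $\mathrm{Sp}(d,\mathbb R)$ is the group of real $2d\times 2d$ matrices $S$ with $S^TJS=J$, where $J=\begin{pmatrix}0_d&I_d\\-I_d&0_d\end{pmatrix}$, written in $d\times d$ blocks $S=\begin{pmatrix}A&B\\C&D\end{pmatrix}$. For $f,g\in L^2(\mathbb R^d)$ the cross-Wigner distribution is $W(f,g)(x,\xi)=\int_{\mathbb R^d}f(x+t/2)\overline{g(x-t/2)}e^{-2\pi i\xi\cdot t}\,dt$. A metaplectic operator with projection $S$ is a unitary operator $\hat S$ on $L^2(\mathbb R^d)$ with $W(\hat Sf,\hat Sg)(z)=W(f,g)(S^{-1}z)$ for all $f,g\in L^2(\mathbb R^d)$, $z\in\mathbb R^{2d}$ (unique up to a unimodular constant). $\ker$ and $R$ denote kernel and range; $Mx\cdot x=(Mx)\cdot x$ with the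 standard inner product. *)

theory Defs
  imports "HOL-Analysis.Analysis"
begin

definition Jblocks_symplectic ::
  "real^'n^'n \<Rightarrow> real^'n^'n \<Rightarrow> real^'n^'n \<Rightarrow> real^'n^'n \<Rightarrow> bool" where
  "Jblocks_symplectic A B C D \<longleftrightarrow>
     transpose A ** C = transpose C ** A \<and>
     transpose B ** D = transpose D ** B \<and>
     transpose A ** D - transpose C ** B = mat 1"
  \<comment> \<open>block form of S^T J S = J with J = [[0, I], [-I, 0]]\<close>

definition block_apply ::
  "real^'n^'n \<Rightarrow> real^'n^'n \<Rightarrow> real^'n^'n \<Rightarrow> real^'n^'n \<Rightarrow>
   ((real^'n) \<times> (real^'n)) \<Rightarrow> ((real^'n) \<times> (real^'n))" where
  "block_apply A B C D z = (A *v fst z + B *v snd z, C *v fst z + D *v snd z)"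

definition L2 :: "(real^'n \<Rightarrow> complex) set" where
  "L2 = {f. f \<in> borel_measurable lebesgue \<and> integrable lebesgue (\<lambda>x. (cmod (f x))\<^sup>2)}"

definition cross_wigner ::
  "(real^'n \<Rightarrow> complex) \<Rightarrow> (real^'n \<Rightarrow> complex) \<Rightarrow> ((real^'n) \<times> (real^'n)) \<Rightarrow> complex" where
  "cross_wigner f g z = integral\<^sup>L lebesgue (\<lambda>t.
      f (fst z + (1/2) *\<^sub>R t) * cnj (g (fst z - (1/2) *\<^sub>R t))
      * exp (- 2 * complex_of_real pi * \<i> * complex_of_real (snd z \<bullet> t)))"

text \<open>A unitary operator on L^2 (acting on representatives, compatible with a.e. equality).\<close>
definition unitary_L2 :: "((real^'n \<Rightarrow> complex) \<Rightarrow> (real^'n \<Rightarrow> complex)) \<Rightarrow> bool" where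
  "unitary_L2 U \<longleftrightarrow>
     (\<forall>f\<in>L2. U f \<in> L2) \<and>
     (\<forall>f\<in>L2. \<forall>g\<in>L2. (AE x in lebesgue. f x = g x) \<longrightarrow> (AE x in lebesgue. U f x = U g x)) \<and>
     (\<forall>f\<in>L2. \<forall>g\<in>L2. \<forall>a b::complex.
        AE x in lebesgue. U (\<lambda>y. a * f y + b * g y) x = a * U f x + b * U g x) \<and>
     (\<forall>f\<in>L2. \<forall>g\<in>L2.
        integral\<^sup>L lebesgue (\<lambda>x. U f x * cnj (U g x)) = integral\<^sup>L lebesgue (\<lambda>x. f x * cnj (g x))) \<and>
     (\<forall>g\<in>L2. \<exists>f\<in>L2. AE x in lebesgue. U f x = g x)"

text \<open>Metaplectic operator with projection S = [[A,B],[C,D]]: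
  W(U f, U g)(z) = W(f,g)(S^{-1} z) for all z, stated equivalently as
  W(U f, U g)(S w) = W(f,g)(w) for all w (S is a bijection).\<close>
definition metaplectic ::
  "real^'n^'n \<Rightarrow> real^'n^'n \<Rightarrow> real^'n^'n \<Rightarrow> real^'n^'n \<Rightarrow>
   ((real^'n \<Rightarrow> complex) \<Rightarrow> (real^'n \<Rightarrow> complex)) \<Rightarrow> bool" where
  "metaplectic A B C D U \<longleftrightarrow> unitary_L2 U \<and>
     (\<forall>f\<in>L2. \<forall>g\<in>L2. \<forall>w.
        cross_wigner (U f) (U g) (block_apply A B C D w) = cross_wigner f g w)"

definition psd_sym :: "real^'n^'n \<Rightarrow> bool" where
  "psd_sym M \<longleftrightarrow> transpose M = M \<and> (\<forall>x. 0 \<le> (M *v x) \<bullet> x)"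

end

theory Submission
  imports Defs "HOL-Probability.Probability" "HOL-Complex_Analysis.Complex_Analysis" "HOL-Real_Asymp.Real_Asymp"
begin

text \<open>
  Let \<open>v\<close> be the eigenvector and \<open>\<eta> = N B v\<close>, scaled so that \<open>v \<bullet> B\<^sup>T \<eta> = 1\<close>. Cauchy-Schwarz for
  \<open>M\<close> and \<open>N\<close> gives \<open>M y \<bullet> y \<ge> lam (v \<bullet> y)\<^sup>2\<close> and \<open>N y \<bullet> y \<ge> (\<eta> \<bullet> y)\<^sup>2\<close>, so only one direction matters.
  Let \<open>h\<close> be \<open>f\<close> cut off to a ball and consider
  \<open>G(z) = \<integral> exp (2 pi i z (\<eta> \<bullet> y)) U f(y) cnj (U h(y)) dy\<close>. The bound on \<open>U f\<close> makes \<open>G\<close> entire with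
  growth \<open>exp (pi mu (Im z)\<^sup>2)\<close> for every \<open>mu > 1\<close>. For real \<open>s\<close>, multiplying by the character
  \<open>s \<eta>\<close> corresponds under \<open>U\<close> to a phase space shift of \<open>h\<close> by \<open>s B\<^sup>T \<eta>\<close>, so the bound on \<open>f\<close> gives
  \<open>\<bar>G(s)\<bar> \<le> K exp (- pi nu s\<^sup>2)\<close> for every \<open>nu < lam\<close>. A Phragmen-Lindelof argument as in
  Hardy's theorem forces \<open>G = 0\<close>, and \<open>G(0) = 0\<close> says that \<open>f\<close> is orthogonal to its own cut-off.

  When \<open>B\<close> is singular, \<open>N\<close> gives no decay along its kernel and the integral need not converge
  for complex \<open>z\<close>. Characters \<open>D \<xi>\<close> with \<open>B \<xi> = 0\<close> correspond to modulations of \<open>h\<close>, which do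
  not change absolute values; averaging them inserts a Gaussian that supplies
  the missing decay, without affecting the estimate on the real axis, and that is removed in the limit.
\<close>

section \<open>Phragmen-Lindelof in a sector\<close>

text \<open>As \<open>b > 2\<close>, the term \<open>e * exp (b * R)\<close> outgrows
  \<open>C * exp (2 * R)\<close>. The latter is growth of order 2 in logarithmic coordinates, the
  former comes from the damping factor in the Phragmen-Lindelof argument.\<close>

lemma double_exp_decay:
  fixes b C e k :: real
  assumes "b > 2" "e > 0"
  shows "((\<lambda>R. k * exp (C * exp (2 * R) - e * exp (b * R))) \<longlongrightarrow> 0) at_top"
proof -
  have 1: "((\<lambda>R. exp (- ((b - 2) * R))) \<longlongrightarrow> 0) at_top"
    using assms by real_asymp
  have "((\<lambda>R. e - C * exp (- ((b - 2) * R))) \<longlongrightarrow> e) at_top"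
    by (rule tendsto_eq_intros refl 1 | simp)+
  moreover have "filterlim (\<lambda>R::real. exp (b * R)) at_top at_top"
    using assms by real_asymp
  ultimately have "filterlim (\<lambda>R. (e - C * exp (- ((b - 2) * R))) * exp (b * R)) at_top at_top"
    using assms(2) by (intro filterlim_tendsto_pos_mult_at_top)
  moreover have "(e - C * exp (- ((b - 2) * R))) * exp (b * R) = - (C * exp (2 * R) - e * exp (b * R))" for R
    by (simp add: algebra_simps flip: exp_add)
  ultimately have "filterlim (\<lambda>R. C * exp (2 * R) - e * exp (b * R)) at_bot at_top"
    by (simp add: filterlim_uminus_at_top)
  then have "((\<lambda>R. exp (C * exp (2 * R) - e * exp (b * R))) \<longlongrightarrow> 0) at_top"
    using exp_at_bot filterlim_compose by blast
  from tendsto_mult_left[OF this, of k] show ?thesis by simp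
qed

text \<open>A damping factor \<open>exp (- e * exp (b * (w - \<i> * t / 2)))\<close> beats the
  assumed growth, so the maximum modulus principle on a long rectangle applies to the product; then
  \<open>e\<close> tends to 0. The half strip is the image of a sector outside the unit disc under
  the logarithm.\<close>

lemma half_strip_Phragmen_Lindelof:
  fixes H :: "complex \<Rightarrow> complex"
  assumes hol: "H holomorphic_on UNIV" and t: "0 < t" "t < pi / 2" and "K > 0"
    and left: "\<And>w. Re w = 0 \<Longrightarrow> 0 \<le> Im w \<Longrightarrow> Im w \<le> t \<Longrightarrow> cmod (H w) \<le> K"
    and bot: "\<And>w. 0 \<le> Re w \<Longrightarrow> Im w = 0 \<Longrightarrow> cmod (H w) \<le> K"
    and top: "\<And>w. 0 \<le> Re w \<Longrightarrow> Im w = t \<Longrightarrow> cmod (H w) \<le> K"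
    and growth: "\<And>w. 0 \<le> Re w \<Longrightarrow> 0 \<le> Im w \<Longrightarrow> Im w \<le> t \<Longrightarrow>
                   cmod (H w) \<le> k * exp (C * exp (2 * Re w))"
    and w: "0 \<le> Re w" "0 \<le> Im w" "Im w \<le> t"
  shows "cmod (H w) \<le> K"
proof -
  \<comment> \<open>The midpoint between \<open>2\<close> and \<open>pi / t\<close>: above 2 to beat
    the growth, below \<open>pi / t\<close> so that \<open>b * (y - t / 2)\<close> stays where the
    cosine is positive.\<close>
  define b where "b = 1 + pi / (2 * t)"
  have b2: "b > 2" using t by (simp add: b_def field_simps)
  define d where "d = cos (b * t / 2)"
  have bt: "b * t / 2 < pi / 2" "b * t / 2 > 0"
  proof -
    show "b * t / 2 < pi / 2" using t by (simp add: b_def field_simps)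
    show "b * t / 2 > 0" using t b2 by simp
  qed
  have d: "d > 0" unfolding d_def using bt by (intro cos_gt_zero_pi) auto
  have cosd: "d \<le> cos (b * (y - t / 2))" if "0 \<le> y" "y \<le> t" for y
  proof -
    have "\<bar>y - t / 2\<bar> \<le> t / 2" using that by linarith
    have "\<bar>b * (y - t / 2)\<bar> = b * \<bar>y - t / 2\<bar>" using b2 by (simp add: abs_mult)
    also have "\<dots> \<le> b * (t / 2)" using b2 \<open>\<bar>y - t / 2\<bar> \<le> t / 2\<close> by (intro mult_left_mono) auto
    finally have "cos (b * t / 2) \<le> cos \<bar>b * (y - t / 2)\<bar>"
      using bt pi_gt_zero by (intro cos_monotone_0_pi_le) auto
    then show ?thesis by (simp add: d_def)
  qed
  have *: "cmod (H w) \<le> K * cmod (exp (of_real e * exp (of_real b * (w - \<i> * of_real (t / 2)))))"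
    if e: "e > 0" for e
  proof -
    define g where "g = (\<lambda>w. exp (- of_real e * exp (of_real b * (w - \<i> * of_real (t / 2)))))"
    have g: "cmod (g x) \<le> exp (- (e * d) * exp (b * Re x))" if "0 \<le> Im x" "Im x \<le> t" for x
    proof -
      have "cmod (g x) = exp (- (e * cos (b * (Im x - t/2))) * exp (b * Re x))"
        by (simp add: g_def Re_exp algebra_simps)
      also have "\<dots> \<le> exp (- (e * d) * exp (b * Re x))"
        using cosd[OF that] e by (simp add: mult_right_mono)
      finally show ?thesis .
    qed
    have g1: "cmod (g x) \<le> 1" if "0 \<le> Im x" "Im x \<le> t" for x
    proof -
      have "exp (- (e * d) * exp (b * Re x)) \<le> 1" using e d by simp
      with g[OF that] show ?thesis by linarith
    qed
    \<comment> \<open>The right edge is moved so far out that the growth of \<open>H\<close> times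
      the decay of \<open>g\<close> falls below \<open>K\<close>. On the other three edges
      \<open>cmod (g x) \<le> 1\<close> suffices.\<close>
    have "\<forall>\<^sub>F R in at_top. k * exp (C * exp (2 * R) - (e * d) * exp (b * R)) < K"
      using double_exp_decay[OF b2, of "e * d" k C] e d \<open>K > 0\<close> by (intro order_tendstoD(2)) auto
    then have "\<forall>\<^sub>F R in at_top. k * exp (C * exp (2 * R) - (e * d) * exp (b * R)) < K \<and> R > Re w \<and> R > 0"
      using eventually_gt_at_top by (intro eventually_conj) auto
    then obtain R where R: "k * exp (C * exp (2 * R) - (e * d) * exp (b * R)) < K" "R > Re w" "R > 0"
      using eventually_happens trivial_limit_at_top_linorder by blast
    have "cmod (H w * g w) \<le> K"
    proof (rule maximum_modulus_frontier[where f="\<lambda>w. H w * g w" and S="cbox 0 (Complex R t)"])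
      have hol': "(\<lambda>w. H w * g w) holomorphic_on S" for S
        unfolding g_def by (intro holomorphic_intros holomorphic_on_subset[OF hol]) auto
      then show "(\<lambda>w. H w * g w) holomorphic_on interior (cbox 0 (Complex R t))"
        "continuous_on (closure (cbox 0 (Complex R t))) (\<lambda>w. H w * g w)"
        by (auto intro: holomorphic_on_imp_continuous_on)
      show "w \<in> cbox 0 (Complex R t)" using w R by (simp add: in_cbox_complex_iff)
      fix z assume "z \<in> frontier (cbox 0 (Complex R t))"
      then have z: "z \<in> cbox 0 (Complex R t)" "z \<notin> box 0 (Complex R t)"
        by (auto simp: frontier_def interior_cbox)
      then have z': "0 \<le> Re z" "0 \<le> Im z" "Im z \<le> t" and "Re z = 0 \<or> Im z = 0 \<or> Im z = t \<or> Re z = R"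
        by (auto simp: in_cbox_complex_iff in_box_complex_iff)
      then consider "cmod (H z) \<le> K" | "Re z = R"
        using left[of z] bot[of z] top[of z] by blast
      then show "cmod (H z * g z) \<le> K"
      proof cases
        case 1
        have "cmod (H z * g z) \<le> K * 1"
          unfolding norm_mult using 1 g1[of z] z' \<open>K > 0\<close> by (intro mult_mono) auto
        then show ?thesis by simp
      next
        case 2
        have "cmod (H z * g z) \<le> (k * exp (C * exp (2 * Re z))) * exp (- (e * d) * exp (b * Re z))"
          unfolding norm_mult using z' growth[of z] g[of z] order_trans[OF norm_ge_zero growth[of z]]
          by (intro mult_mono) auto
        also have "\<dots> = k * exp (C * exp (2 * R) - (e * d) * exp (b * R))"
          by (simp add: 2 exp_diff exp_minus field_simps)
        finally show ?thesis using R by simp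
      qed
    qed simp_all
    moreover have "H w * g w = H w / exp (of_real e * exp (of_real b * (w - \<i> * of_real (t / 2))))"
      by (simp add: g_def exp_minus field_simps)
    ultimately show ?thesis by (simp add: norm_divide field_simps del: norm_exp_eq_Re)
  qed
  have "((\<lambda>e. K * cmod (exp (of_real e * exp (of_real b * (w - \<i> * of_real (t / 2)))))) \<longlongrightarrow>
          K * cmod (exp (of_real 0 * exp (of_real b * (w - \<i> * of_real (t / 2)))))) (at_right 0)"
    by (intro tendsto_intros)
  moreover have "\<forall>\<^sub>F e in at_right 0. cmod (H w) \<le>
      K * cmod (exp (of_real e * exp (of_real b * (w - \<i> * of_real (t / 2)))))"
    by (rule eventually_mono[OF eventually_at_right_less]) (rule *)
  ultimately have "cmod (H w) \<le> K * cmod (exp (of_real 0 * exp (of_real b * (w - \<i> * of_real (t / 2)))))"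
    by (intro tendsto_lowerbound) auto
  then show ?thesis by simp
qed

text \<open>Only the part outside the unit disc and below the ray of angle \<open>t\<close> needs
  work. The logarithm maps it into a half strip, whose left, lower and upper edges correspond to the
  unit circle, the real axis and the ray.\<close>

lemma quadrant_bound:
  fixes F :: "complex \<Rightarrow> complex"
  assumes hol: "F holomorphic_on UNIV" and t: "0 < t" "t < pi / 2" and "K > 0"
    and disc: "\<And>z. cmod z \<le> 1 \<Longrightarrow> cmod (F z) \<le> K"
    and real: "\<And>x. cmod (F (of_real x)) \<le> K"
    and vert: "\<And>z. 0 \<le> Re z \<Longrightarrow> Re z * tan t \<le> Im z \<Longrightarrow> cmod (F z) \<le> K"
    and growth: "\<And>z. cmod (F z) \<le> k * exp (C * (cmod z)\<^sup>2)"
    and z: "0 \<le> Re z" "0 \<le> Im z"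
  shows "cmod (F z) \<le> K"
proof (cases "cmod z \<le> 1 \<or> Re z * tan t \<le> Im z")
  case True
  then show ?thesis using disc vert z by blast
next
  case False
  then have nz: "z \<noteq> 0" "cmod z > 1" and lt: "Im z < Re z * tan t" by auto
  then have "Re z > 0" using z by (cases "Re z = 0") auto
  define w where "w = Ln z"
  have zw: "z = exp w" using nz by (simp add: w_def)
  have Imw: "Im w = arctan (Im z / Re z)"
    using \<open>Re z > 0\<close> unfolding w_def by (subst Im_Ln_eq) (auto simp: Im_Ln_eq nz)
  have tt: "arctan (tan t) = t" using t by (intro arctan_tan) auto
  have "Im z / Re z \<le> tan t" using lt \<open>Re z > 0\<close> by (simp add: field_simps)
  then have w: "0 \<le> Im w" "Im w \<le> t"
    using \<open>Re z > 0\<close> z(2) tt by (auto simp: Imw) (metis arctan_le_iff tt)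
  have "cmod ((\<lambda>w. F (exp w)) w) \<le> K"
  proof (rule half_strip_Phragmen_Lindelof[OF _ t \<open>K > 0\<close> _ _ _ _ _ w])
    show "(\<lambda>w. F (exp w)) holomorphic_on UNIV"
      using holomorphic_on_compose_gen[OF holomorphic_on_exp hol, of UNIV] by (simp add: o_def)
    show "0 \<le> Re w" using nz by (simp add: w_def)
    show "cmod (F (exp w)) \<le> K" if "Re w = 0" for w
      using that by (intro disc) simp
    show "cmod (F (exp w)) \<le> K" if "Im w = 0" for w
    proof -
      have "exp w = of_real (exp (Re w))" using that by (simp add: complex_eq_iff Re_exp Im_exp)
      then show ?thesis using real by metis
    qed
    show "cmod (F (exp w)) \<le> K" if "Im w = t" for w
    proof (rule vert)
      have "cos t > 0" using t by (intro cos_gt_zero_pi) auto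
      then show "Re (exp w) * tan t \<le> Im (exp w)" "0 \<le> Re (exp w)"
        by (simp_all add: Re_exp Im_exp that tan_def)
    qed
    show "cmod (F (exp w)) \<le> k * exp (C * exp (2 * Re w))" for w
      using growth[of "exp w"] by (simp add: power2_eq_square flip: exp_add)
  qed
  then show ?thesis by (simp add: zw)
qed

text \<open>Multiplying by \<open>exp (pi a z\<^sup>2)\<close> with \<open>mu < a < nu\<close> gives an entire function that is bounded
  on the real axis and on a double sector around the imaginary axis; the four remaining sectors
  have opening less than \<open>pi / 2\<close>, so Phragmen-Lindelof applies to the order 2.\<close>

lemma entire_Gaussian_bounds_imp_zero:
  fixes G :: "complex \<Rightarrow> complex"
  assumes hol: "G holomorphic_on UNIV" and "0 < mu" "mu < nu"
    and growth: "\<And>z. cmod (G z) \<le> K * exp (pi * mu * (Im z)\<^sup>2)"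
    and decay: "\<And>s. cmod (G (of_real s)) \<le> K * exp (- pi * nu * s\<^sup>2)"
  shows "G z = 0"
proof -
  obtain a where a: "mu < a" "a < nu" using \<open>mu < nu\<close> dense by blast
  \<comment> \<open>\<open>G\<close> is an argument of \<open>F\<close> so that the estimate in one
    quadrant can be reused for the reflections of \<open>G\<close>.\<close>
  define F where "F = (\<lambda>G z. G z * exp (of_real (pi * a) * z\<^sup>2) :: complex)"
  have K: "K \<ge> 0" using growth[of 0] order_trans[OF norm_ge_zero] by fastforce
  have nF: "cmod (F G z) = cmod (G z) * exp (pi * a * ((Re z)\<^sup>2 - (Im z)\<^sup>2))" for G z
    by (simp add: F_def norm_mult power2_eq_square algebra_simps)
  \<comment> \<open>The slope of the ray on which
    \<open>mu * (Im z)\<^sup>2 + a * ((Re z)\<^sup>2 - (Im z)\<^sup>2)\<close> vanishes; above it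
    this exponent is at most 0.\<close>
  define q where "q = sqrt (a / (a - mu))"
  have q: "q > 0" "q\<^sup>2 = a / (a - mu)" using a \<open>0 < mu\<close> by (auto simp: q_def)
  \<comment> \<open>The first summand bounds \<open>F G\<close> on the unit disc; the 1 keeps
    \<open>K'\<close> positive when \<open>K = 0\<close>.\<close>
  define K' where "K' = K * exp (pi * (a + mu)) + 1"
  have K': "K' > 0" "K \<le> K'"
  proof -
    have "K * 1 \<le> K * exp (pi * (a + mu))"
      using K a \<open>0 < mu\<close> by (intro mult_left_mono) auto
    then show "K' > 0" "K \<le> K'" using K by (auto simp: K'_def)
  qed
  have quad: "cmod (F G z) \<le> K'"
    if hol: "G holomorphic_on UNIV"
      and growth: "\<And>z. cmod (G z) \<le> K * exp (pi * mu * (Im z)\<^sup>2)"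
      and decay: "\<And>s. cmod (G (of_real s)) \<le> K * exp (- pi * nu * s\<^sup>2)"
      and z: "0 \<le> Re z" "0 \<le> Im z" for G z
  proof -
    have grow: "cmod (F G z) \<le> K * exp (pi * (mu * (Im z)\<^sup>2 + a * ((Re z)\<^sup>2 - (Im z)\<^sup>2)))" for z
    proof -
      have "cmod (F G z) \<le> (K * exp (pi * mu * (Im z)\<^sup>2)) * exp (pi * a * ((Re z)\<^sup>2 - (Im z)\<^sup>2))"
        unfolding nF by (intro mult_right_mono growth) simp
      then show ?thesis by (simp add: exp_add ring_distribs mult.assoc)
    qed
    have grow2: "cmod (F G z) \<le> K * exp (pi * (a + mu) * (cmod z)\<^sup>2)" for z
    proof -
      have "mu * (Im z)\<^sup>2 + a * ((Re z)\<^sup>2 - (Im z)\<^sup>2) \<le> (a + mu) * (cmod z)\<^sup>2"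
        using a \<open>0 < mu\<close> by (simp add: cmod_power2 ring_distribs)
      then have "exp (pi * (mu * (Im z)\<^sup>2 + a * ((Re z)\<^sup>2 - (Im z)\<^sup>2))) \<le> exp (pi * (a + mu) * (cmod z)\<^sup>2)"
        by (simp add: mult.assoc)
      with K show ?thesis by (intro order_trans[OF grow]) (intro mult_left_mono)
    qed
    show ?thesis
    proof (rule quadrant_bound[where F="F G" and z=z and t="arctan q" and C="pi * (a + mu)" and k=K, OF _ _ _ K'(1)])
      show "F G holomorphic_on UNIV" unfolding F_def by (intro holomorphic_intros hol)
      show "0 < arctan q" "arctan q < pi / 2" using q arctan_ubound[of q] by auto
      show "cmod (F G z) \<le> K'" if "cmod z \<le> 1" for z
      proof -
        have "(cmod z)\<^sup>2 \<le> 1" using that by (simp add: power_le_one)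
        then have "pi * (a + mu) * (cmod z)\<^sup>2 \<le> pi * (a + mu) * 1" using a \<open>0 < mu\<close>
          by (intro mult_left_mono) auto
        then have "K * exp (pi * (a + mu) * (cmod z)\<^sup>2) \<le> K * exp (pi * (a + mu))"
          using K by (intro mult_left_mono) auto
        then show ?thesis using grow2[of z] by (simp add: K'_def)
      qed
      show "cmod (F G (of_real x)) \<le> K'" for x
      proof -
        have "cmod (F G (of_real x)) \<le> K * exp (- pi * nu * x\<^sup>2) * exp (pi * a * x\<^sup>2)"
          unfolding nF using decay[of x] K by (intro mult_mono) auto
        also have "\<dots> = K * exp (pi * (a - nu) * x\<^sup>2)"
          by (simp add: left_diff_distrib right_diff_distrib exp_diff exp_minus field_simps)
        also have "\<dots> \<le> K * 1"
          using a K by (intro mult_left_mono) (auto simp: mult_le_0_iff zero_le_mult_iff)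
        finally show ?thesis using K' by simp
      qed
      show "cmod (F G z) \<le> K'" if "Re z * tan (arctan q) \<le> Im z" "0 \<le> Re z" for z
      proof -
        have "(Re z * q)\<^sup>2 \<le> (Im z)\<^sup>2" using that q by (intro power_mono) (auto simp: tan_arctan)
        then have "(Re z)\<^sup>2 * a \<le> (Im z)\<^sup>2 * (a - mu)"
          using a q(2) by (simp add: power_mult_distrib field_simps)
        then have "mu * (Im z)\<^sup>2 + a * ((Re z)\<^sup>2 - (Im z)\<^sup>2) \<le> 0"
          by (simp add: algebra_simps)
        then have "exp (pi * (mu * (Im z)\<^sup>2 + a * ((Re z)\<^sup>2 - (Im z)\<^sup>2))) \<le> 1"
          by (simp add: mult_nonneg_nonpos)
        then have "K * exp (pi * (mu * (Im z)\<^sup>2 + a * ((Re z)\<^sup>2 - (Im z)\<^sup>2))) \<le> K * 1"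
          using K by (intro mult_left_mono) auto
        with grow[of z] K' show ?thesis by simp
      qed
      show "cmod (F G z) \<le> K * exp (pi * (a + mu) * (cmod z)\<^sup>2)" for z by (rule grow2)
    qed (use z in auto)
  qed
  \<comment> \<open>The maps \<open>- z\<close>, \<open>cnj z\<close> and \<open>- cnj z\<close>
    carry the other quadrants to the first. The correspondingly reflected functions are entire and
    satisfy the same two bounds, since these involve only squares of \<open>Im z\<close> and
    \<open>s\<close>.\<close>
  have bdd: "cmod (F G z) \<le> K'" for z
  proof -
    have cU: "cnj ` UNIV = UNIV" by (metis complex_cnj_cnj surjI)
    have hcnj: "(\<lambda>z. cnj (G (cnj z))) holomorphic_on UNIV"
      using holomorphic_on_compose_cnj_cnj[of G UNIV] hol by (simp add: o_def cU)
    have hm: "(\<lambda>z. G (- z)) holomorphic_on UNIV"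
      using holomorphic_on_compose_gen[OF _ hol, of uminus UNIV] by (simp add: o_def holomorphic_on_minus)
    have hmc: "(\<lambda>z. cnj (G (- cnj z))) holomorphic_on UNIV"
      using holomorphic_on_compose_cnj_cnj[of "\<lambda>z. G (- z)" UNIV] hm by (simp add: o_def cU)
    consider "0 \<le> Re z" "0 \<le> Im z" | "0 \<ge> Re z" "0 \<ge> Im z" | "0 \<le> Re z" "0 \<ge> Im z" | "0 \<ge> Re z" "0 \<le> Im z"
      by linarith
    then show ?thesis
    proof cases
      case 1 then show ?thesis using quad[OF hol growth decay] by blast
    next
      case 2
      have "cmod (F (\<lambda>z. G (- z)) (- z)) \<le> K'"
        using 2 growth[of "- _"] decay[of "- _"] by (intro quad[OF hm]) auto
      then show ?thesis by (simp add: nF)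
    next
      case 3
      have "cmod (F (\<lambda>z. cnj (G (cnj z))) (cnj z)) \<le> K'"
        using 3 growth[of "cnj _"] decay by (intro quad[OF hcnj]) auto
      then show ?thesis by (simp add: nF)
    next
      case 4
      have "cmod (F (\<lambda>z. cnj (G (- cnj z))) (- cnj z)) \<le> K'"
        using 4 growth[of "- cnj _"] decay[of "- _"] by (intro quad[OF hmc]) auto
      then show ?thesis by (simp add: nF)
    qed
  qed
  \<comment> \<open>Liouville makes the product constant, and along the real axis it tends to 0
    because \<open>a < nu\<close>.\<close>
  have "F G constant_on UNIV"
    using bdd by (intro Liouville_theorem) (auto simp: bounded_iff F_def intro!: holomorphic_intros hol)
  then obtain c where c: "\<And>z. F G z = c" by (auto simp: constant_on_def)
  have "cmod c \<le> K * exp (pi * (a - nu) * s\<^sup>2)" for s :: real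
  proof -
    have "cmod (F G (of_real s)) \<le> K * exp (- pi * nu * s\<^sup>2) * exp (pi * a * s\<^sup>2)"
      unfolding nF using decay[of s] K by (intro mult_mono) auto
    also have "\<dots> = K * exp (pi * (a - nu) * s\<^sup>2)"
      by (simp add: left_diff_distrib right_diff_distrib exp_diff exp_minus field_simps)
    finally show ?thesis by (simp add: c)
  qed
  moreover have "((\<lambda>s::real. K * exp (pi * (a - nu) * s\<^sup>2)) \<longlongrightarrow> 0) at_top"
  proof -
    have "((\<lambda>s::real. exp (- (pi * (nu - a)) * s\<^sup>2)) \<longlongrightarrow> 0) at_top"
      using a pi_gt_zero by real_asymp
    from tendsto_mult_left[OF this, of K] show ?thesis by (simp add: algebra_simps)
  qed
  ultimately have "cmod c \<le> 0" 
    by (intro tendsto_lowerbound[of _ 0 at_top]) auto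
  then show ?thesis using c[of z] by (simp add: F_def)
qed

section \<open>Symplectic blocks and the eigenvector\<close>

lemma psd_sym_inner_commute:
  assumes "psd_sym M"
  shows "(M *v x) \<bullet> y = (M *v y) \<bullet> x"
  using assms by (metis psd_sym_def dot_lmul_matrix inner_commute transpose_matrix_vector)

lemma psd_sym_Cauchy_Schwarz:
  assumes "psd_sym M"
  shows "((M *v x) \<bullet> y)\<^sup>2 \<le> ((M *v x) \<bullet> x) * ((M *v y) \<bullet> y)"
proof -
  define a b c where "a = (M *v x) \<bullet> x" and "b = (M *v x) \<bullet> y" and "c = (M *v y) \<bullet> y"
  have nonneg: "0 \<le> (M *v z) \<bullet> z" for z using assms by (simp add: psd_sym_def)
  have q: "0 \<le> a + 2 * t * b + t\<^sup>2 * c" for t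
    using nonneg[of "x + t *\<^sub>R y"] psd_sym_inner_commute[OF assms, of y x]
    by (simp add: a_def b_def c_def matrix_vector_right_distrib matrix_vector_mult_scaleR
        inner_left_distrib inner_right_distrib power2_eq_square algebra_simps)
  have "b\<^sup>2 \<le> a * c"
  proof (cases "c = 0")
    case True
    have "b = 0"
    proof (rule ccontr)
      assume "b \<noteq> 0"
      \<comment> \<open>At this \<open>t\<close> the expression, affine in \<open>t\<close> because
        \<open>c = 0\<close>, takes the value -1.\<close>
      then show False using q[of "- (a + 1) / (2 * b)"] True by (simp add: field_simps)
    qed
    then show ?thesis using True by simp
  next
    case False
    then have c: "c > 0" using nonneg[of y] by (simp add: c_def)
    \<comment> \<open>\<open>t = - b / c\<close> minimises the quadratic polynomial.\<close>
    have "0 \<le> (a + 2 * (- b / c) * b + (- b / c)\<^sup>2 * c) * c"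
      using q[of "- b / c"] c by (intro mult_nonneg_nonneg) auto
    then show ?thesis using c by (simp add: power2_eq_square field_simps)
  qed
  then show ?thesis by (simp add: a_def b_def c_def)
qed

lemma psd_sym_inner_self_eq_0:
  assumes "psd_sym M" "(M *v x) \<bullet> x = 0"
  shows "M *v x = 0"
  using psd_sym_Cauchy_Schwarz[OF assms(1), of x "M *v x"] assms(2) by simp

text \<open>With \<open>u = transpose B *v \<eta>\<close> the eigenvalue equation becomes
  \<open>M *v u = lam *\<^sub>R v\<close>, hence \<open>(M *v u) \<bullet> u = lam\<close>.
  Cauchy-Schwarz for \<open>M\<close> at \<open>u\<close> gives the first bound after cancelling
  \<open>lam\<close>; for \<open>N\<close> at \<open>B *v v\<close>, scaled so that the form has
  value 1 there, it gives the second.\<close>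

lemma eigenvalue_rank_one_bounds:
  fixes B M N :: "real^'n^'n"
  assumes M: "psd_sym M" and N: "psd_sym N"
    and lam: "lam > 0" "v0 \<noteq> 0" "(M ** transpose B ** N ** B) *v v0 = lam *\<^sub>R v0"
  obtains v \<eta> where "v \<bullet> (transpose B *v \<eta>) = 1"
    "\<And>y. lam * (v \<bullet> y)\<^sup>2 \<le> (M *v y) \<bullet> y" "\<And>y. (\<eta> \<bullet> y)\<^sup>2 \<le> (N *v y) \<bullet> y"
proof -
  define k where "k = (N *v (B *v v0)) \<bullet> (B *v v0)"
  have eig: "M *v (transpose B *v (N *v (B *v v0))) = lam *\<^sub>R v0"
    using lam(3) by (simp add: matrix_vector_mul_assoc matrix_mul_assoc)
  have "k \<noteq> 0"
  proof
    assume "k = 0"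
    then have "N *v (B *v v0) = 0" using psd_sym_inner_self_eq_0[OF N] by (simp add: k_def)
    then show False using eig lam by simp
  qed
  then have k: "k > 0" using N by (simp add: k_def psd_sym_def less_le)
  define v where "v = (1 / sqrt k) *\<^sub>R v0"
  define \<eta> where "\<eta> = N *v (B *v v)"
  define u where "u = transpose B *v \<eta>"
  have Bu: "x \<bullet> u = (B *v x) \<bullet> \<eta>" for x
    unfolding u_def by (metis dot_lmul_matrix inner_commute transpose_matrix_vector)
  have nB: "(N *v (B *v v)) \<bullet> (B *v v) = 1"
    using k by (simp add: v_def matrix_vector_mult_scaleR flip: k_def)
  have vu: "v \<bullet> u = 1" using nB unfolding Bu by (simp add: \<eta>_def inner_commute)
  have Mu: "M *v u = lam *\<^sub>R v"
    using eig by (simp add: u_def \<eta>_def v_def matrix_vector_mult_scaleR)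
  show thesis
  proof
    show "v \<bullet> (transpose B *v \<eta>) = 1" using vu by (simp add: u_def)
    show "lam * (v \<bullet> y)\<^sup>2 \<le> (M *v y) \<bullet> y" for y
    proof -
      have "lam * (lam * (v \<bullet> y)\<^sup>2) \<le> lam * ((M *v y) \<bullet> y)"
        using psd_sym_Cauchy_Schwarz[OF M, of u y] vu by (simp add: Mu power2_eq_square ac_simps)
      then show ?thesis using lam(1) by simp
    qed
    show "(\<eta> \<bullet> y)\<^sup>2 \<le> (N *v y) \<bullet> y" for y
      using psd_sym_Cauchy_Schwarz[OF N, of "B *v v" y] nB by (simp add: \<eta>_def)
  qed
qed

text \<open>The inverse of \<open>S\<close> is \<open>[[D\<^sup>T, -B\<^sup>T], [-C\<^sup>T, A\<^sup>T]]\<close>; the relations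
  \<open>S\<^sup>T J S = J\<close> say that it is a left inverse.\<close>

lemma symplectic_right_inverse:
  assumes "Jblocks_symplectic A B C D"
  shows "A *v (transpose B *v w) = B *v (transpose A *v w)"
    and "D *v (transpose A *v w) - C *v (transpose B *v w) = w"
proof -
  define S where "S = block_apply A B C D"
  define L where "L = block_apply (transpose D) (- transpose B) (- transpose C) (transpose A)"
  have lin: "linear S" "linear L"
    unfolding S_def L_def block_apply_def
    by (auto intro!: linearI simp: matrix_vector_right_distrib matrix_vector_mult_scaleR algebra_simps simp del: transpose_matrix_vector)
  have 1: "transpose A ** C = transpose C ** A" "transpose B ** D = transpose D ** B"
    "transpose A ** D - transpose C ** B = mat 1"
    using assms by (auto simp: Jblocks_symplectic_def)
  \<comment> \<open>The transpose of the third relation, which supplies the other diagonal block of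
    the left inverse identity.\<close>
  have 2: "transpose D ** A - transpose B ** C = mat 1"
    using arg_cong[OF 1(3), of transpose]
    by (simp add: matrix_transpose_mul transpose_mat transpose_def vec_eq_iff matrix_matrix_mult_def mult.commute mat_def)
  have v1: "transpose A *v (C *v x) = transpose C *v (A *v x)" 
    "transpose B *v (D *v x) = transpose D *v (B *v x)" 
    "transpose A *v (D *v x) - transpose C *v (B *v x) = x" 
    "transpose D *v (A *v x) - transpose B *v (C *v x) = x" for x
    using 1 2 by (simp_all add: matrix_vector_mul_assoc flip: matrix_vector_mult_diff_rdistrib)
  have minus: "(- X) *v y = - (X *v y)" for X :: "real^'n^'n" and y
    using matrix_vector_mult_diff_rdistrib[of 0 X y] by simp
  have minus': "X *v (- y) = - (X *v y)" for X :: "real^'n^'n" and y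
    using matrix_vector_mult_diff_distrib[of X 0 y] by simp
  have "L (S z) = z" for z
    using v1(1)[of "fst z"] v1(2)[of "snd z"] v1(3)[of "snd z"] v1(4)[of "fst z"]
    by (simp add: L_def S_def block_apply_def matrix_vector_right_distrib minus prod_eq_iff algebra_simps)
  \<comment> \<open>In finite dimension a linear left inverse is two-sided; the claims are the two
    components of this identity at \<open>(0, w)\<close>.\<close>
  then have "S (L z) = z" for z
    using linear_inverse_left[OF lin(2,1)] by (cases z) (simp add: fun_eq_iff)
  from this[of "(0, w)"]
  show "A *v (transpose B *v w) = B *v (transpose A *v w)"
    and "D *v (transpose A *v w) - C *v (transpose B *v w) = w"
    by (auto simp: L_def S_def block_apply_def minus minus' prod_eq_iff)
qed

text \<open>A vector \<open>y\<close> killed by the symmetric \<open>N\<close> is orthogonal to the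
  range of \<open>N\<close>, which is that of \<open>B\<close>, so
  \<open>transpose B *v y = 0\<close>. Then \<open>y = D *v (transpose A *v y)\<close> with
  \<open>transpose A *v y\<close> in the kernel of \<open>B\<close>, so \<open>y\<close> is
  orthogonal to itself. This is why weights along the image of that kernel under \<open>D\<close>
  supply exactly the decay missing from \<open>N\<close>.\<close>

lemma symplectic_joint_kernel_trivial:
  assumes S: "Jblocks_symplectic A B C D" and N: "psd_sym N"
    and range: "range (\<lambda>x. N *v x) = range (\<lambda>x. B *v x)"
    and y: "N *v y = 0" "\<And>\<xi>. B *v \<xi> = 0 \<Longrightarrow> (D *v \<xi>) \<bullet> y = 0"
  shows "y = 0"
proof -
  have "(B *v x) \<bullet> y = 0" for x
  proof -
    obtain x' where "B *v x = N *v x'" using range by blast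
    then show ?thesis using psd_sym_inner_commute[OF N, of x' y] y(1) by simp
  qed
  then have "x \<bullet> (transpose B *v y) = 0" for x
    by (metis dot_lmul_matrix inner_commute transpose_matrix_vector)
  then have "transpose B *v y = 0" using inner_eq_zero_iff by blast
  with symplectic_right_inverse[OF S, of y] have "B *v (transpose A *v y) = 0" "D *v (transpose A *v y) = y"
    by auto
  then show ?thesis using y(2)[of "transpose A *v y"] by simp
qed

section \<open>Metaplectic operators and phase space shifts\<close>

lemma lebesgue_scaleR_affine:
  fixes t :: "'a::euclidean_space"
  assumes "c \<noteq> 0"
  shows measurable_lebesgue_scaleR_affine: "(\<lambda>x. t + c *\<^sub>R x) \<in> lebesgue \<rightarrow>\<^sub>M lebesgue"
    and lebesgue_eq_density_distr_affine:
      "lebesgue = density (distr lebesgue lebesgue (\<lambda>x. t + c *\<^sub>R x)) (\<lambda>_. ennreal (\<bar>c\<bar> ^ DIM('a)))"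
proof -
  have eq: "t + c *\<^sub>R x = t + (\<Sum>j\<in>Basis. (c * (x \<bullet> j)) *\<^sub>R j)" for x
    using euclidean_representation[of x] by (simp flip: scaleR_scaleR scaleR_right.sum)
  show "(\<lambda>x. t + c *\<^sub>R x) \<in> lebesgue \<rightarrow>\<^sub>M lebesgue"
    unfolding eq using assms by (intro lebesgue_affine_measurable) auto
  show "lebesgue = density (distr lebesgue lebesgue (\<lambda>x. t + c *\<^sub>R x)) (\<lambda>_. ennreal (\<bar>c\<bar> ^ DIM('a)))"
    unfolding eq using lebesgue_affine_euclidean[of "\<lambda>_. c" t] assms by simp
qed

lemma measurable_affine_compose:
  fixes f :: "'a::euclidean_space \<Rightarrow> 'b::topological_space"
  assumes "f \<in> borel_measurable lebesgue" "c \<noteq> 0"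
  shows "(\<lambda>x. f (t + c *\<^sub>R x)) \<in> borel_measurable lebesgue"
  using measurable_compose[OF measurable_lebesgue_scaleR_affine[OF assms(2)] assms(1)] .

lemma
  fixes f :: "'a::euclidean_space \<Rightarrow> 'b::{banach, second_countable_topology}"
  assumes f: "f \<in> borel_measurable lebesgue" and c: "c \<noteq> 0"
  shows integral_lebesgue_affine:
      "integral\<^sup>L lebesgue f = (\<bar>c\<bar> ^ DIM('a)) *\<^sub>R integral\<^sup>L lebesgue (\<lambda>x. f (t + c *\<^sub>R x))"
    and integrable_lebesgue_affine_iff:
      "integrable lebesgue (\<lambda>x. f (t + c *\<^sub>R x)) \<longleftrightarrow> integrable lebesgue f"
proof -
  note [measurable] = f measurable_lebesgue_scaleR_affine[OF c, of t]
  show "integral\<^sup>L lebesgue f = (\<bar>c\<bar> ^ DIM('a)) *\<^sub>R integral\<^sup>L lebesgue (\<lambda>x. f (t + c *\<^sub>R x))"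
    by (subst lebesgue_eq_density_distr_affine[OF c, of t]) (simp add: integral_density integral_distr)
  show "integrable lebesgue (\<lambda>x. f (t + c *\<^sub>R x)) \<longleftrightarrow> integrable lebesgue f"
  proof -
    let ?k = "\<bar>c\<bar> ^ DIM('a)"
    have "integrable lebesgue f \<longleftrightarrow> integrable lebesgue (\<lambda>x. ?k *\<^sub>R f (t + c *\<^sub>R x))"
      by (subst lebesgue_eq_density_distr_affine[OF c, of t]) (simp add: integrable_density integrable_distr_eq)
    also have "\<dots> \<longleftrightarrow> integrable lebesgue (\<lambda>x. f (t + c *\<^sub>R x))"
      using c Bochner_Integration.integrable_scaleR_right[of "inverse ?k" lebesgue "\<lambda>x. ?k *\<^sub>R f (t + c *\<^sub>R x)"]
      by auto
    finally show ?thesis ..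
  qed
qed

lemma AE_lebesgue_affine:
  fixes t :: "'a::euclidean_space"
  assumes "AE x in lebesgue. P x" and c: "c \<noteq> 0"
  shows "AE x in lebesgue. P (t + c *\<^sub>R x)"
proof -
  obtain N where N: "{x. \<not> P x} \<subseteq> N" "N \<in> null_sets lebesgue"
    using assms(1) by (auto elim!: AE_E simp: null_sets_def)
  let ?T = "\<lambda>x. t + c *\<^sub>R x"
  have Nm: "N \<in> sets lebesgue" using N by auto
  have m: "?T -` N \<in> sets lebesgue"
    using measurable_sets[OF measurable_lebesgue_scaleR_affine[OF c, of t] Nm] by simp
  have "emeasure lebesgue N = ennreal (\<bar>c\<bar> ^ DIM('a)) * emeasure lebesgue (?T -` N)"
    using measurable_lebesgue_scaleR_affine[OF c, of t] Nm
    by (subst lebesgue_eq_density_distr_affine[OF c, of t])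
      (simp add: emeasure_density_const emeasure_distr)
  then have "emeasure lebesgue (?T -` N) = 0" using N c by (auto simp: null_sets_def)
  with m have "?T -` N \<in> null_sets lebesgue" by auto
  then show ?thesis by (rule AE_I') (use N in auto)
qed

lemma borel_measurable_cnj [measurable]:
  "f \<in> borel_measurable M \<Longrightarrow> (\<lambda>x. cnj (f x)) \<in> borel_measurable M"
  by (rule measurable_compose[of f M borel]) (auto intro: borel_measurable_continuous_onI continuous_intros)

section \<open>Square-integrable functions\<close>

lemma L2_I: "f \<in> borel_measurable lebesgue \<Longrightarrow> integrable lebesgue (\<lambda>x. (cmod (f x))\<^sup>2) \<Longrightarrow> f \<in> L2"
  by (simp add: L2_def)

lemma L2_measurable: "f \<in> L2 \<Longrightarrow> f \<in> borel_measurable lebesgue"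
  by (simp add: L2_def)

lemma L2_norm_integrable: "f \<in> L2 \<Longrightarrow> integrable lebesgue (\<lambda>x. (cmod (f x))\<^sup>2)"
  by (simp add: L2_def)

lemma L2_cmult_bounded:
  assumes "f \<in> L2" and m[measurable]: "m \<in> borel_measurable lebesgue" and "\<And>x. cmod (m x) \<le> K"
  shows "(\<lambda>x. f x * m x) \<in> L2"
proof (rule L2_I)
  note [measurable] = L2_measurable[OF assms(1)]
  show "(\<lambda>x. f x * m x) \<in> borel_measurable lebesgue" by measurable
  have "integrable lebesgue (\<lambda>x. K\<^sup>2 * (cmod (f x))\<^sup>2)"
    using L2_norm_integrable[OF assms(1)] by simp
  then show "integrable lebesgue (\<lambda>x. (cmod (f x * m x))\<^sup>2)"
  proof (rule Bochner_Integration.integrable_bound)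
    show "AE x in lebesgue. norm ((cmod (f x * m x))\<^sup>2) \<le> norm (K\<^sup>2 * (cmod (f x))\<^sup>2)"
    proof (intro AE_I2)
      fix x
      have "(cmod (m x))\<^sup>2 * (cmod (f x))\<^sup>2 \<le> K\<^sup>2 * (cmod (f x))\<^sup>2"
        using assms(3) by (intro mult_right_mono power_mono) auto
      then show "norm ((cmod (f x * m x))\<^sup>2) \<le> norm (K\<^sup>2 * (cmod (f x))\<^sup>2)"
        by (simp add: norm_mult power_mult_distrib mult.commute)
    qed
  qed measurable
qed

lemma L2_mult_integrable:
  assumes "f \<in> L2" "g \<in> L2"
  shows "integrable lebesgue (\<lambda>x. f x * g x)"
proof (rule Bochner_Integration.integrable_bound)
  note [measurable] = assms[THEN L2_measurable]
  show "integrable lebesgue (\<lambda>x. (cmod (f x))\<^sup>2 + (cmod (g x))\<^sup>2)"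
    using assms by (intro Bochner_Integration.integrable_add L2_norm_integrable)
  show "(\<lambda>x. f x * g x) \<in> borel_measurable lebesgue" by measurable
  show "AE x in lebesgue. norm (f x * g x) \<le> norm ((cmod (f x))\<^sup>2 + (cmod (g x))\<^sup>2)"
  proof (intro AE_I2)
    fix x
    have "0 \<le> (cmod (f x) - cmod (g x))\<^sup>2" "0 \<le> (cmod (f x))\<^sup>2" "0 \<le> (cmod (g x))\<^sup>2" by simp_all
    then have "cmod (f x) * cmod (g x) \<le> (cmod (f x))\<^sup>2 + (cmod (g x))\<^sup>2"
      unfolding power2_diff by linarith
    then show "norm (f x * g x) \<le> norm ((cmod (f x))\<^sup>2 + (cmod (g x))\<^sup>2)"
      by (simp add: norm_mult)
  qed
qed

lemma L2_cnj: "f \<in> L2 \<Longrightarrow> (\<lambda>x. cnj (f x)) \<in> L2"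
  by (auto simp: L2_def intro: borel_measurable_cnj)

lemma L2_diff:
  assumes "f \<in> L2" "g \<in> L2"
  shows "(\<lambda>x. f x - g x) \<in> L2"
proof (rule L2_I)
  note [measurable] = assms[THEN L2_measurable]
  show "(\<lambda>x. f x - g x) \<in> borel_measurable lebesgue" by measurable
  have "integrable lebesgue (\<lambda>x. 2 * (cmod (f x))\<^sup>2 + 2 * (cmod (g x))\<^sup>2)"
    using assms by (intro Bochner_Integration.integrable_add integrable_mult_right L2_norm_integrable)
  then show "integrable lebesgue (\<lambda>x. (cmod (f x - g x))\<^sup>2)"
  proof (rule Bochner_Integration.integrable_bound)
    show "AE x in lebesgue. norm ((cmod (f x - g x))\<^sup>2) \<le> norm (2 * (cmod (f x))\<^sup>2 + 2 * (cmod (g x))\<^sup>2)"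
    proof (intro AE_I2)
      fix x
      have "(cmod (f x - g x))\<^sup>2 \<le> (cmod (f x) + cmod (g x))\<^sup>2"
        by (intro power_mono norm_triangle_ineq4) simp
      also have "\<dots> \<le> 2 * (cmod (f x))\<^sup>2 + 2 * (cmod (g x))\<^sup>2"
        using zero_le_power2[of "cmod (f x) - cmod (g x)"] unfolding power2_diff power2_sum by linarith
      finally show "norm ((cmod (f x - g x))\<^sup>2) \<le> norm (2 * (cmod (f x))\<^sup>2 + 2 * (cmod (g x))\<^sup>2)" by simp
    qed
  qed measurable
qed

lemma L2_affine:
  assumes "f \<in> L2" "c \<noteq> 0"
  shows "(\<lambda>x. f (t + c *\<^sub>R x)) \<in> L2"
  using assms integrable_lebesgue_affine_iff[of "\<lambda>x. (cmod (f x))\<^sup>2" c t]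
  by (auto simp: L2_def measurable_affine_compose)

text \<open>Testing with \<open>F = a - b\<close> yields that the norm of \<open>a - b\<close> is
  0.\<close>

lemma L2_eq_AE:
  assumes "a \<in> L2" "b \<in> L2"
    and "\<And>F. F \<in> L2 \<Longrightarrow> integral\<^sup>L lebesgue (\<lambda>x. F x * cnj (a x)) = integral\<^sup>L lebesgue (\<lambda>x. F x * cnj (b x))"
  shows "AE x in lebesgue. a x = b x"
proof -
  define F where "F = (\<lambda>x. a x - b x)"
  have F: "F \<in> L2" unfolding F_def using assms by (intro L2_diff)
  have "integral\<^sup>L lebesgue (\<lambda>x. F x * cnj (a x) - F x * cnj (b x)) = 0"
    using assms(3)[OF F] F assms(1,2) by (simp add: L2_mult_integrable L2_cnj)
  moreover have "F x * cnj (a x) - F x * cnj (b x) = of_real ((cmod (F x))\<^sup>2)" for x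
    using complex_norm_square[of "F x"] by (simp add: F_def algebra_simps)
  ultimately have "integral\<^sup>L lebesgue (\<lambda>x. (cmod (F x))\<^sup>2) = 0"
    by (simp only: integral_complex_of_real) simp
  then have "AE x in lebesgue. (cmod (F x))\<^sup>2 = 0"
    using L2_norm_integrable[OF F] by (subst (asm) integral_nonneg_eq_0_iff_AE) auto
  then show ?thesis by (auto simp: F_def)
qed

text \<open>Up to the factor \<open>2\<^sup>d\<close> the cross-Wigner distribution is a matrix coefficient of the
  Grossmann-Royer operators \<open>parity_op w\<close>; two of them compose to a phase space shift.\<close>

definition parity_op :: "(real^'n) \<times> (real^'n) \<Rightarrow> (real^'n \<Rightarrow> complex) \<Rightarrow> (real^'n \<Rightarrow> complex)" where
  "parity_op w g = (\<lambda>y. g (2 *\<^sub>R fst w - y) * exp (4 * complex_of_real pi * \<i> * of_real (snd w \<bullet> (y - fst w))))"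

text \<open>The Heisenberg-Weyl operator in symmetric form. Centring the phase at half the
  translation makes the composition of two parity operators equal to it without an extra
  scalar.\<close>

definition phase_shift :: "(real^'n) \<times> (real^'n) \<Rightarrow> (real^'n \<Rightarrow> complex) \<Rightarrow> (real^'n \<Rightarrow> complex)" where
  "phase_shift w g = (\<lambda>y. g (y - fst w) * exp (2 * complex_of_real pi * \<i> * of_real (snd w \<bullet> (y - (1/2) *\<^sub>R fst w))))"

lemma measurable_lebesgue_character [measurable]:
  fixes q p :: "'a::euclidean_space"
  shows "(\<lambda>y. exp (k * complex_of_real (q \<bullet> (y - p)))) \<in> borel_measurable lebesgue"
proof -
  have "(\<lambda>y. exp (k * complex_of_real (q \<bullet> (y - p)))) \<in> borel_measurable borel" by measurable
  then show ?thesis by (simp add: measurable_completion)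
qed

lemma parity_op_L2:
  assumes "g \<in> L2" shows "parity_op w g \<in> L2"
proof -
  have "(\<lambda>y. g (2 *\<^sub>R fst w + (- 1) *\<^sub>R y)) \<in> L2" using assms by (rule L2_affine) simp
  then show ?thesis unfolding parity_op_def
    by (intro L2_cmult_bounded[where K=1]) (auto intro: measurable_lebesgue_character)
qed

text \<open>The substitution \<open>t = 2 * (y - fst w)\<close> turns \<open>fst w + t / 2\<close>
  into \<open>y\<close> and \<open>fst w - t / 2\<close> into the reflected point; its Jacobian is
  the power of 2.\<close>

lemma cross_wigner_eq_parity_op:
  fixes f g :: "real^'n \<Rightarrow> complex"
  assumes "f \<in> L2" "g \<in> L2"
  shows "cross_wigner f g w = 2 ^ CARD('n) * integral\<^sup>L lebesgue (\<lambda>y. f y * cnj (parity_op w g y))"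
proof -
  have fg: "(\<lambda>t. f (fst w + (1/2) *\<^sub>R t)) \<in> borel_measurable lebesgue"
    "(\<lambda>t. g (fst w - (1/2) *\<^sub>R t)) \<in> borel_measurable lebesgue"
    using assms[THEN L2_measurable] measurable_affine_compose[of f "1/2" "fst w"]
      measurable_affine_compose[of g "- (1/2)" "fst w"] by simp_all
  have m: "(\<lambda>t. f (fst w + (1/2) *\<^sub>R t) * cnj (g (fst w - (1/2) *\<^sub>R t))
      * exp (- 2 * complex_of_real pi * \<i> * complex_of_real (snd w \<bullet> t))) \<in> borel_measurable lebesgue"
    using fg measurable_lebesgue_character[of "- 2 * complex_of_real pi * \<i>" "snd w" 0]
    by (auto intro!: borel_measurable_times borel_measurable_cnj)
  have "f (fst w + (1/2) *\<^sub>R t) * cnj (g (fst w - (1/2) *\<^sub>R t))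
      * exp (- 2 * complex_of_real pi * \<i> * complex_of_real (snd w \<bullet> t)) = f y * cnj (parity_op w g y)"
    if t: "t = - 2 *\<^sub>R fst w + 2 *\<^sub>R y" for t y
  proof -
    have "fst w + (1/2) *\<^sub>R t = y" by (simp add: t scaleR_add_right scaleR_diff_right)
    moreover have "fst w - (1/2) *\<^sub>R t = 2 *\<^sub>R fst w - y"
      by (simp add: t scaleR_add_right scaleR_diff_right scaleR_2)
    moreover have "snd w \<bullet> t = 2 * (snd w \<bullet> (y - fst w))"
      by (simp add: t inner_add_right inner_diff_right)
    ultimately show ?thesis by (simp add: parity_op_def exp_cnj mult.assoc mult.commute mult.left_commute)
  qed
  then show ?thesis
    unfolding cross_wigner_def
    by (subst integral_lebesgue_affine[OF m, of 2 "- 2 *\<^sub>R fst w"]) (simp_all add: scaleR_conv_of_real)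
qed

text \<open>Wigner covariance and the isometry property equate the inner products of both sides with
  every \<open>U f\<close>. Since \<open>U\<close> is onto up to null sets, these test functions
  exhaust \<open>L2\<close>.\<close>

lemma metaplectic_parity_op:
  fixes g :: "real^'n \<Rightarrow> complex"
  assumes met: "metaplectic A B C D U" and g: "g \<in> L2"
  shows "AE y in lebesgue. U (parity_op w g) y = parity_op (block_apply A B C D w) (U g) y"
proof (rule L2_eq_AE)
  have U: "unitary_L2 U" and W: "\<And>f g w. f \<in> L2 \<Longrightarrow> g \<in> L2 \<Longrightarrow>
      cross_wigner (U f) (U g) (block_apply A B C D w) = cross_wigner f g w"
    using met by (auto simp: metaplectic_def)
  have UL2: "\<And>f. f \<in> L2 \<Longrightarrow> U f \<in> L2" and
    iso: "\<And>f g. f \<in> L2 \<Longrightarrow> g \<in> L2 \<Longrightarrow>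
        integral\<^sup>L lebesgue (\<lambda>x. U f x * cnj (U g x)) = integral\<^sup>L lebesgue (\<lambda>x. f x * cnj (g x))" and
    surj: "\<And>g. g \<in> L2 \<Longrightarrow> \<exists>f\<in>L2. AE x in lebesgue. U f x = g x"
    using U by (auto simp: unitary_L2_def)
  show L2s: "U (parity_op w g) \<in> L2" "parity_op (block_apply A B C D w) (U g) \<in> L2"
    using g by (auto intro: UL2 parity_op_L2)
  fix F :: "real^'n \<Rightarrow> complex" assume F: "F \<in> L2"
  then obtain f where f: "f \<in> L2" "AE x in lebesgue. U f x = F x" using surj by blast
  note [measurable] = F[THEN L2_measurable] UL2[OF f(1), THEN L2_measurable] L2s[THEN L2_measurable]
  have "integral\<^sup>L lebesgue (\<lambda>x. F x * cnj (U (parity_op w g) x))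
      = integral\<^sup>L lebesgue (\<lambda>x. U f x * cnj (U (parity_op w g) x))"
    using f(2) by (intro integral_cong_AE) auto
  also have "\<dots> = integral\<^sup>L lebesgue (\<lambda>x. f x * cnj (parity_op w g x))"
    using f g by (intro iso parity_op_L2)
  also have "\<dots> = integral\<^sup>L lebesgue (\<lambda>x. U f x * cnj (parity_op (block_apply A B C D w) (U g) x))"
    using W[OF f(1) g, of w] f g UL2 by (simp add: cross_wigner_eq_parity_op)
  also have "\<dots> = integral\<^sup>L lebesgue (\<lambda>x. F x * cnj (parity_op (block_apply A B C D w) (U g) x))"
    using f(2) by (intro integral_cong_AE) auto
  finally show "integral\<^sup>L lebesgue (\<lambda>x. F x * cnj (U (parity_op w g) x)) =
      integral\<^sup>L lebesgue (\<lambda>x. F x * cnj (parity_op (block_apply A B C D w) (U g) x))" .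
qed

lemma parity_op_parity_op_0: "parity_op w (parity_op 0 g) = phase_shift (2 *\<^sub>R w) g"
  by (auto simp: parity_op_def phase_shift_def fun_eq_iff algebra_simps)

text \<open>A phase space shift is a product of two parity operators, the second centred at the
  origin, which \<open>S\<close> fixes. \<open>U\<close> intertwines each factor, hence the shift by
  \<open>w\<close> with the shift by its image, and the isometry property concludes.\<close>

lemma metaplectic_phase_shift_coefficient:
  fixes f g :: "real^'n \<Rightarrow> complex"
  assumes met: "metaplectic A B C D U" and f: "f \<in> L2" and g: "g \<in> L2"
  shows "integral\<^sup>L lebesgue (\<lambda>x. U f x * cnj (phase_shift (block_apply A B C D w) (U g) x)) =
    integral\<^sup>L lebesgue (\<lambda>x. f x * cnj (phase_shift w g x))"
proof -
  define S where "S = block_apply A B C D"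
  have UL2: "\<And>f. f \<in> L2 \<Longrightarrow> U f \<in> L2" and
    iso: "\<And>f g. f \<in> L2 \<Longrightarrow> g \<in> L2 \<Longrightarrow>
        integral\<^sup>L lebesgue (\<lambda>x. U f x * cnj (U g x)) = integral\<^sup>L lebesgue (\<lambda>x. f x * cnj (g x))"
    using met by (auto simp: metaplectic_def unitary_L2_def)
  define w' where "w' = (1/2) *\<^sub>R w"
  have w': "phase_shift w g = parity_op w' (parity_op 0 g)" for g :: "real^'n \<Rightarrow> complex"
    by (simp add: parity_op_parity_op_0 w'_def)
  have Sw': "phase_shift (S w) g = parity_op (S w') (parity_op 0 g)" for g :: "real^'n \<Rightarrow> complex"
    by (simp add: parity_op_parity_op_0 w'_def S_def block_apply_def matrix_vector_mult_scaleR
        scaleR_add_right)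
  have S0: "S 0 = 0" by (simp add: S_def block_apply_def zero_prod_def)
  define P where "P = parity_op 0 g"
  have P: "P \<in> L2" unfolding P_def using g by (rule parity_op_L2)
  have L2s: "U f \<in> L2" "U P \<in> L2" "parity_op (S w') (U P) \<in> L2" "parity_op 0 (U g) \<in> L2"
    "parity_op (S w') (parity_op 0 (U g)) \<in> L2" "U (parity_op w' P) \<in> L2"
    using f g P by (auto intro!: UL2 parity_op_L2)
  note [measurable] = L2s[THEN L2_measurable]
  have "AE y in lebesgue. U P y = parity_op 0 (U g) y"
    using metaplectic_parity_op[OF met g, of 0] by (simp add: P_def flip: S_def) (simp add: S0)
  \<comment> \<open>The outer parity operator evaluates its argument at a reflected point, so the
    exceptional null set has to be reflected as well.\<close>
  from AE_lebesgue_affine[OF this, of "- 1" "2 *\<^sub>R fst (S w')"]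
  have 1: "AE y in lebesgue. parity_op (S w') (U P) y = parity_op (S w') (parity_op 0 (U g)) y"
    by (auto simp: parity_op_def[of "S w'"] elim!: eventually_mono)
  have 2: "AE y in lebesgue. U (parity_op w' P) y = parity_op (S w') (U P) y"
    using metaplectic_parity_op[OF met P, of w'] by (simp add: S_def)
  have "integral\<^sup>L lebesgue (\<lambda>x. U f x * cnj (phase_shift (S w) (U g) x)) =
      integral\<^sup>L lebesgue (\<lambda>x. U f x * cnj (U (parity_op w' P) x))"
    unfolding Sw' using 1 2 by (intro integral_cong_AE) auto
  also have "\<dots> = integral\<^sup>L lebesgue (\<lambda>x. f x * cnj (phase_shift w g x))"
    unfolding w' P_def using f g by (intro iso parity_op_L2)
  finally show ?thesis by (simp add: S_def)
qed

section \<open>Gaussian multipliers and exponential integrals\<close>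

text \<open>Required for Fubini with the completed measure; a countable cover by Borel sets of
  finite measure still serves.\<close>

lemma sigma_finite_lebesgue: "sigma_finite_measure (lebesgue :: 'a::euclidean_space measure)"
proof
  obtain A :: "'a set set" where A: "countable A \<and> A \<subseteq> sets lborel \<and> \<Union>A = space lborel \<and>
      (\<forall>a\<in>A. emeasure lborel a \<noteq> \<infinity>)"
    by (rule exE[OF sigma_finite_measure.sigma_finite_countable[OF sigma_finite_lborel]])
  then show "\<exists>A. countable A \<and> A \<subseteq> sets lebesgue \<and> \<Union>A = space (lebesgue :: 'a measure) \<and>
      (\<forall>a\<in>A. emeasure lebesgue a \<noteq> \<infinity>)"
    by (intro exI[of _ A]) (auto simp: emeasure_completion subset_iff)
qed

lemma integrable_lebesgue_Gaussian:
  assumes "k > 0"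
  shows "integrable lebesgue (\<lambda>x::'a::euclidean_space. exp (- k * (norm x)\<^sup>2))"
proof -
  define \<sigma> where "\<sigma> = sqrt (1 / (2 * k))"
  have \<sigma>: "\<sigma> > 0" "2 * \<sigma>\<^sup>2 = 1 / k" using assms by (auto simp: \<sigma>_def)
  have "integrable lborel (\<lambda>x::real. sqrt (2 * pi * \<sigma>\<^sup>2) * normal_density 0 \<sigma> x)"
    using \<sigma> by (intro integrable_mult_right) simp
  also have "(\<lambda>x::real. sqrt (2 * pi * \<sigma>\<^sup>2) * normal_density 0 \<sigma> x) = (\<lambda>x. exp (- k * x\<^sup>2))"
    using \<sigma> assms by (auto simp: normal_density_def fun_eq_iff field_simps)
  finally have 1: "(\<integral>\<^sup>+ x. ennreal (exp (- k * x\<^sup>2)) \<partial>lborel) < \<infinity>"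
    by (simp add: integrable_iff_bounded)
  have prod: "exp (- k * (norm x)\<^sup>2) = (\<Prod>b\<in>Basis. exp (- k * (x \<bullet> b)\<^sup>2))" for x :: 'a
    unfolding power2_norm_eq_inner euclidean_inner[of x x]
    by (simp add: exp_sum sum_distrib_left power2_eq_square flip: sum_negf)
  have "integrable lborel (\<lambda>x::'a. exp (- k * (norm x)\<^sup>2))"
  proof (rule integrableI_bounded)
    have "(\<integral>\<^sup>+ x. ennreal (norm (exp (- k * (norm (x::'a))\<^sup>2))) \<partial>lborel) =
        (\<integral>\<^sup>+ x. (\<Prod>b\<in>Basis. ennreal (exp (- k * ((x::'a) \<bullet> b)\<^sup>2))) \<partial>lborel)"
      unfolding prod by (simp add: prod_ennreal prod_nonneg)
    also have "\<dots> = (\<Prod>b\<in>(Basis :: 'a set). (\<integral>\<^sup>+ x. ennreal (exp (- k * x\<^sup>2)) \<partial>lborel))"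
      by (rule nn_integral_lborel_prod) auto
    also have "\<dots> < \<infinity>" using 1 by (simp add: power_less_top_ennreal)
    finally show "(\<integral>\<^sup>+ x. ennreal (norm (exp (- k * (norm (x::'a))\<^sup>2))) \<partial>lborel) < \<infinity>" .
  qed auto
  then show ?thesis by (intro integrable_completion[THEN iffD2]) auto
qed

text \<open>\<open>k\<close> is the minimum of \<open>Q\<close> on the compact unit sphere;
  homogeneity extends the bound to all vectors.\<close>

lemma positive_form_lower_bound:
  fixes Q :: "'a::euclidean_space \<Rightarrow> real"
  assumes cont: "continuous_on UNIV Q" and hom: "\<And>r x. Q (r *\<^sub>R x) = r\<^sup>2 * Q x"
    and pos: "\<And>x. x \<noteq> 0 \<Longrightarrow> Q x > 0"
  obtains k where "k > 0" "\<And>x. k * (norm x)\<^sup>2 \<le> Q x"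
proof -
  have ne: "sphere (0::'a) 1 \<noteq> {}" by simp
  obtain x0 where x0: "x0 \<in> sphere 0 1" "\<And>x. x \<in> sphere 0 1 \<Longrightarrow> Q x0 \<le> Q x"
    using continuous_attains_inf[OF compact_sphere ne continuous_on_subset[OF cont subset_UNIV]] by blast
  show thesis
  proof
    show "Q x0 > 0" using x0(1) by (intro pos) auto
    show "Q x0 * (norm x)\<^sup>2 \<le> Q x" for x
    proof (cases "x = 0")
      case True
      then show ?thesis using hom[of 0 0] by simp
    next
      case False
      have "Q x0 \<le> Q ((1 / norm x) *\<^sub>R x)" using False by (intro x0(2)) simp
      then show ?thesis using False hom[of "norm x" "(1 / norm x) *\<^sub>R x"]
        by (simp add: mult.commute mult_left_mono)
    qed
  qed
qed

lemma measurable_lebesgue_exp_inner [measurable]: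
  fixes q :: "'a::euclidean_space"
  shows "(\<lambda>y. exp (k * complex_of_real (q \<bullet> y))) \<in> borel_measurable lebesgue"
proof -
  have "(\<lambda>y. exp (k * complex_of_real (q \<bullet> y))) \<in> borel_measurable borel" by measurable
  then show ?thesis by (simp add: measurable_completion)
qed

lemma measurable_lebesgue_inner [measurable]:
  fixes q :: "'a::euclidean_space"
  shows "(\<lambda>y. q \<bullet> y) \<in> borel_measurable lebesgue"
proof -
  have "(\<lambda>y. q \<bullet> y) \<in> borel_measurable borel" by measurable
  then show ?thesis by (simp add: measurable_completion)
qed

abbreviation character :: "'a::real_inner \<Rightarrow> 'a \<Rightarrow> complex" where
  "character q y \<equiv> exp (2 * complex_of_real pi * \<i> * complex_of_real (q \<bullet> y))"

text \<open>A Gaussian is an average of characters, namely the characteristic function of the standard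
  normal distribution.\<close>

lemma Gaussian_multiplier_bound:
  fixes \<Phi> :: "'a::euclidean_space \<Rightarrow> complex"
  assumes \<Phi>: "integrable lebesgue \<Phi>"
    and bd: "\<And>t. cmod (integral\<^sup>L lebesgue (\<lambda>y. character (q + t *\<^sub>R a) y * \<Phi> y)) \<le> K"
  shows "cmod (integral\<^sup>L lebesgue (\<lambda>y. character q y * (of_real (exp (- (a \<bullet> y)\<^sup>2 / 2)) * \<Phi> y))) \<le> K"
proof -
  interpret N: real_distribution std_normal_distribution by (rule real_dist_normal_dist)
  interpret L: sigma_finite_measure "lebesgue :: 'a measure" by (rule sigma_finite_lebesgue)
  interpret P: pair_sigma_finite std_normal_distribution "lebesgue :: 'a measure" ..
  note [measurable] = borel_measurable_integrable[OF \<Phi>]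
  define F where "F = (\<lambda>t y. iexp (t * (a \<bullet> y)) * (character q y * \<Phi> y))"
  have nF: "cmod (F t y) = cmod (\<Phi> y)" for t y by (simp add: F_def norm_mult)
  have intF: "integrable lebesgue (F t)" for t
    using \<Phi> by (rule Bochner_Integration.integrable_bound) (auto simp: nF, auto simp: F_def)
  have meas: "case_prod F \<in> borel_measurable (std_normal_distribution \<Otimes>\<^sub>M lebesgue)"
    unfolding F_def by measurable
  have intP: "integrable (std_normal_distribution \<Otimes>\<^sub>M lebesgue) (case_prod F)"
    using meas by (rule P.Fubini_integrable) (auto simp: nF intF)
  have K: "cmod (integral\<^sup>L lebesgue (F t)) \<le> K" for t
  proof -
    \<comment> \<open>The frequency is divided by \<open>2 * pi\<close> because
      \<open>character\<close> contains this factor and \<open>iexp\<close> does not.\<close>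
    have "F t = (\<lambda>y. character (q + (t / (2 * pi)) *\<^sub>R a) y * \<Phi> y)"
      by (rule ext) (simp add: F_def inner_add_left ring_distribs exp_add)
    then show ?thesis using bd[of "t / (2 * pi)"] by (simp only:)
  qed
  have "of_real (exp (- (a \<bullet> y)\<^sup>2 / 2)) = (CLINT t|std_normal_distribution. iexp (t * (a \<bullet> y)))" for y
    using fun_cong[OF char_std_normal_distribution, of "a \<bullet> y"] by (simp add: char_def mult.commute)
  then have "integral\<^sup>L lebesgue (\<lambda>y. character q y * (of_real (exp (- (a \<bullet> y)\<^sup>2 / 2)) * \<Phi> y)) =
      (\<integral>y. (CLINT t|std_normal_distribution. F t y) \<partial>lebesgue)"
    by (simp add: F_def mult.assoc mult.left_commute)
  \<comment> \<open>After the exchange every inner integral is bounded by \<open>K\<close>, and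
    averaging against a probability measure keeps the constant.\<close>
  also have "\<dots> = (CLINT t|std_normal_distribution. (integral\<^sup>L lebesgue (F t)))"
    by (rule P.Fubini_integral[OF intP])
  also have "cmod \<dots> \<le> (LINT t|std_normal_distribution. cmod (integral\<^sup>L lebesgue (F t)))"
    by simp
  also have "\<dots> \<le> (LINT t|std_normal_distribution. K)"
  proof (rule integral_mono)
    show "integrable std_normal_distribution (\<lambda>t. cmod (integral\<^sup>L lebesgue (F t)))"
      using P.integrable_fst'[OF intP] by simp
  qed (auto simp: K)
  also have "\<dots> = K" using N.prob_space by simp
  finally show ?thesis .
qed

text \<open>The Gaussian factors are inserted one at a time. The induction carries the bound for all
  \<open>w\<close> in \<open>V\<close>, since each averaging step shifts the frequency by multiples
  of \<open>a\<close>, and \<open>V\<close> is closed under this.\<close>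

lemma Gaussian_product_multiplier_bound:
  fixes \<Phi> :: "'a::euclidean_space \<Rightarrow> complex"
  assumes X: "finite X" "X \<subseteq> V" and V: "subspace V" and \<Phi>: "integrable lebesgue \<Phi>"
    and bd: "\<And>w. w \<in> V \<Longrightarrow> cmod (integral\<^sup>L lebesgue (\<lambda>y. character (q + w) y * \<Phi> y)) \<le> K"
    and w: "w \<in> V"
  shows "integrable lebesgue (\<lambda>y. of_real (exp (- (\<Sum>a\<in>X. (a \<bullet> y)\<^sup>2) / 2)) * \<Phi> y)"
    and "cmod (integral\<^sup>L lebesgue (\<lambda>y. character (q + w) y *
      (of_real (exp (- (\<Sum>a\<in>X. (a \<bullet> y)\<^sup>2) / 2)) * \<Phi> y))) \<le> K"
proof -
  have "integrable lebesgue (\<lambda>y. of_real (exp (- (\<Sum>a\<in>X. (a \<bullet> y)\<^sup>2) / 2)) * \<Phi> y) \<and>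
    (\<forall>w\<in>V. cmod (integral\<^sup>L lebesgue (\<lambda>y. character (q + w) y *
      (of_real (exp (- (\<Sum>a\<in>X. (a \<bullet> y)\<^sup>2) / 2)) * \<Phi> y))) \<le> K)" (is "integrable _ (?\<Phi> X) \<and> ?P X")
    using X
  proof (induction X rule: finite_induct)
    case empty
    then show ?case using bd \<Phi> by simp
  next
    case (insert a X)
    then have IH: "integrable lebesgue (?\<Phi> X)" "?P X" and a: "a \<in> V" by auto
    have "exp (- (\<Sum>a\<in>insert a X. (a \<bullet> y)\<^sup>2) / 2) =
        exp (- (a \<bullet> y)\<^sup>2 / 2) * exp (- (\<Sum>a\<in>X. (a \<bullet> y)\<^sup>2) / 2)" for y
      using insert.hyps by (simp add: add_divide_distrib diff_divide_distrib flip: exp_add)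
    then have eq: "?\<Phi> (insert a X) = (\<lambda>y. of_real (exp (- (a \<bullet> y)\<^sup>2 / 2)) * ?\<Phi> X y)"
      by (simp add: mult.assoc)
    have "integrable lebesgue (?\<Phi> (insert a X))"
      unfolding eq using IH(1)
    proof (rule Bochner_Integration.integrable_bound)
      note [measurable] = borel_measurable_integrable[OF IH(1)]
      show "(\<lambda>y. of_real (exp (- (a \<bullet> y)\<^sup>2 / 2)) * ?\<Phi> X y) \<in> borel_measurable lebesgue"
        by measurable
      show "AE y in lebesgue. norm (of_real (exp (- (a \<bullet> y)\<^sup>2 / 2)) * ?\<Phi> X y) \<le> norm (?\<Phi> X y)"
        by (intro AE_I2) (simp add: norm_mult mult_left_le_one_le)
    qed
    moreover have "?P (insert a X)"
    proof
      fix w assume w: "w \<in> V"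
      have "cmod (integral\<^sup>L lebesgue (\<lambda>y. character (q + w) y *
          (of_real (exp (- (a \<bullet> y)\<^sup>2 / 2)) * ?\<Phi> X y))) \<le> K"
      proof (rule Gaussian_multiplier_bound[OF IH(1)])
        fix t
        have "w + t *\<^sub>R a \<in> V" using V w a by (auto intro: subspace_add subspace_scale)
        then show "cmod (integral\<^sup>L lebesgue (\<lambda>y. character (q + w + t *\<^sub>R a) y * ?\<Phi> X y)) \<le> K"
          using IH(2) by (simp add: add.assoc)
      qed
      then show "cmod (integral\<^sup>L lebesgue (\<lambda>y. character (q + w) y * ?\<Phi> (insert a X) y)) \<le> K"
        by (simp only: fun_cong[OF eq])
    qed
    ultimately show ?case by blast
  qed
  then show "integrable lebesgue (?\<Phi> X)"
    and "cmod (integral\<^sup>L lebesgue (\<lambda>y. character (q + w) y * ?\<Phi> X y)) \<le> K"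
    using w by auto
qed

text \<open>Expanding the exponential and integrating term by term gives a power series converging
  everywhere; the partial sums of the norms are dominated by
  \<open>exp (r * \<bar>l x\<bar>) * cmod (\<Phi> x)\<close>.\<close>

lemma entire_exponential_integral:
  fixes \<Phi> :: "'a \<Rightarrow> complex" and l :: "'a \<Rightarrow> real"
  assumes [measurable]: "\<Phi> \<in> borel_measurable M" "l \<in> borel_measurable M"
    and int: "\<And>r. r > 0 \<Longrightarrow> integrable M (\<lambda>x. exp (r * \<bar>l x\<bar>) * cmod (\<Phi> x))"
  shows "(\<lambda>z. integral\<^sup>L M (\<lambda>x. exp (z * of_real (l x)) * \<Phi> x)) holomorphic_on UNIV"
proof -
  define c where "c = (\<lambda>n. integral\<^sup>L M (\<lambda>x. of_real (l x) ^ n / fact n * \<Phi> x))"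
  define G where "G = (\<lambda>z. integral\<^sup>L M (\<lambda>x. exp (z * of_real (l x)) * \<Phi> x))"
  have sums: "(\<lambda>n. c n * z ^ n) sums G z" for z
  proof -
    \<comment> \<open>The 1 ensures \<open>r > 0\<close> also at \<open>z = 0\<close>, as the
      integrability hypothesis demands.\<close>
    define r where "r = cmod z + 1"
    have r: "r > 0" "cmod z \<le> r" by (auto simp: r_def add_nonneg_pos)
    define f where "f = (\<lambda>n x. z ^ n * (of_real (l x) ^ n / fact n * \<Phi> x))"
    have nf: "norm (f n x) = (cmod z * \<bar>l x\<bar>) ^ n / fact n * cmod (\<Phi> x)" for n x
      by (simp add: f_def norm_mult norm_divide norm_power power_mult_distrib)
    have exps: "(\<lambda>n. (cmod z * \<bar>l x\<bar>) ^ n / fact n) sums exp (cmod z * \<bar>l x\<bar>)" for x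
      using exp_converges[of "cmod z * \<bar>l x\<bar>"] by (simp add: scaleR_conv_of_real divide_inverse mult.commute)
    have nsums: "(\<lambda>n. norm (f n x)) sums (exp (cmod z * \<bar>l x\<bar>) * cmod (\<Phi> x))" for x
      unfolding nf by (intro sums_mult2 exps)
    have le: "exp (cmod z * \<bar>l x\<bar>) * cmod (\<Phi> x) \<le> exp (r * \<bar>l x\<bar>) * cmod (\<Phi> x)" for x
      using r by (intro mult_right_mono) (auto intro: mult_right_mono)
    have part: "(\<Sum>n<m. norm (f n x)) \<le> exp (r * \<bar>l x\<bar>) * cmod (\<Phi> x)" for m x
      using sum_le_suminf[OF sums_summable[OF nsums], of "{..<m}" x] sums_unique[OF nsums, of x] le[of x]
      by simp
    have fm[measurable]: "f n \<in> borel_measurable M" for n unfolding f_def by measurable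
    have fint: "integrable M (f n)" for n
      using int[OF r(1)]
    proof (rule Bochner_Integration.integrable_bound)
      have "norm (f n x) \<le> exp (r * \<bar>l x\<bar>) * cmod (\<Phi> x)" for x
      proof -
        have "norm (f n x) \<le> (\<Sum>k<Suc n. norm (f k x))"
          by (rule member_le_sum) auto
        with part[where m="Suc n" and x=x] show ?thesis by linarith
      qed
      then show "AE x in M. norm (f n x) \<le> norm (exp (r * \<bar>l x\<bar>) * cmod (\<Phi> x))" by simp
    qed measurable
    have "(\<lambda>n. integral\<^sup>L M (f n)) sums (\<integral>x. (\<Sum>n. f n x) \<partial>M)"
    proof (rule sums_integral[OF fint])
      show "AE x in M. summable (\<lambda>n. norm (f n x))" using nsums by (auto intro: sums_summable)
      show "summable (\<lambda>n. \<integral>x. norm (f n x) \<partial>M)"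
      proof (rule summableI_nonneg_bounded)
        fix m
        have "(\<Sum>n<m. \<integral>x. norm (f n x) \<partial>M) = (\<integral>x. (\<Sum>n<m. norm (f n x)) \<partial>M)"
          using fint by (simp add: Bochner_Integration.integral_sum)
        also have "\<dots> \<le> (\<integral>x. exp (r * \<bar>l x\<bar>) * cmod (\<Phi> x) \<partial>M)"
          using fint int[OF r(1)] part by (intro integral_mono) auto
        finally show "(\<Sum>n<m. \<integral>x. norm (f n x) \<partial>M) \<le> (\<integral>x. exp (r * \<bar>l x\<bar>) * cmod (\<Phi> x) \<partial>M)" .
      qed simp
    qed
    moreover have "integral\<^sup>L M (f n) = c n * z ^ n" for n
      by (simp add: f_def c_def mult.commute)
    moreover have "(\<Sum>n. f n x) = exp (z * of_real (l x)) * \<Phi> x" for x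
    proof -
      have "(\<lambda>n. (z * of_real (l x)) ^ n / fact n) sums exp (z * of_real (l x))"
        using exp_converges[of "z * of_real (l x)"]
        by (simp add: scaleR_conv_of_real divide_inverse mult.commute)
      from sums_mult2[OF this, of "\<Phi> x"] show ?thesis
        by (simp add: f_def power_mult_distrib sums_iff mult.assoc)
    qed
    ultimately show ?thesis by (simp add: G_def)
  qed
  have "G holomorphic_on ball 0 r" for r
    using sums by (intro power_series_holomorphic[where a=c]) auto
  then have "G field_differentiable at z" for z
    by (rule holomorphic_on_imp_differentiable_at[OF _ open_ball, of _ 0 "cmod z + 1"]) simp
  then show ?thesis unfolding G_def[symmetric] by (simp add: holomorphic_on_def field_differentiable_at_within)
qed

section \<open>The entire function of the proof\<close>

text \<open>The symplectic map sends \<open>(transpose B *v w, - (transpose A *v w))\<close> to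
  \<open>(0, - w)\<close>, a pure modulation whose conjugate is multiplication by
  \<open>character w\<close>.\<close>

lemma modulated_coefficient_eq:
  fixes f h :: "real^'n \<Rightarrow> complex"
  assumes S: "Jblocks_symplectic A B C D" and met: "metaplectic A B C D U" and f: "f \<in> L2" and h: "h \<in> L2"
  shows "integral\<^sup>L lebesgue (\<lambda>y. character w y * (U f y * cnj (U h y))) =
    integral\<^sup>L lebesgue (\<lambda>y. f y * cnj (phase_shift (transpose B *v w, - (transpose A *v w)) h y))"
proof -
  have minus: "X *v (- y) = - (X *v y)" for X :: "real^'n^'n" and y
    using matrix_vector_mult_diff_distrib[of X 0 y] by simp
  have "block_apply A B C D (transpose B *v w, - (transpose A *v w)) = (0, - w)"
    using symplectic_right_inverse[OF S, of w]
    by (simp add: block_apply_def minus algebra_simps del: transpose_matrix_vector)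
  moreover have "character w y * (U f y * cnj (U h y)) = U f y * cnj (phase_shift (0, - w) (U h) y)" for y
    by (simp add: phase_shift_def exp_cnj mult_ac)
  ultimately show ?thesis
    using metaplectic_phase_shift_coefficient[OF met f h, of "(transpose B *v w, - (transpose A *v w))"]
    by (simp only:)
qed

text \<open>On the support of the shifted \<open>h\<close> the value \<open>v \<bullet> y\<close>
  differs from \<open>s\<close> by at most a fixed \<open>r\<close>, so \<open>f\<close> is small
  there. Lowering the rate from \<open>lam\<close> to \<open>nu\<close> absorbs this displacement
  into a constant independent of \<open>s\<close> and \<open>w\<close>.\<close>

lemma shifted_coefficient_decay:
  fixes f h :: "real^'n \<Rightarrow> complex" and p :: "real \<Rightarrow> (real^'n) \<times> (real^'n)"
  assumes f: "f \<in> L2" and h: "h \<in> L2" "integrable lebesgue h"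
    and bd: "AE y in lebesgue. cmod (f y) \<le> c * exp (- pi * lam * (v \<bullet> y)\<^sup>2)"
    and supp: "\<And>y. norm y \<ge> R \<Longrightarrow> h y = 0"
    and "0 < nu" "nu < lam" "0 \<le> c"
  obtains K where "\<And>s w. v \<bullet> fst w = s \<Longrightarrow>
    cmod (integral\<^sup>L lebesgue (\<lambda>y. f y * cnj (phase_shift w h y))) \<le> K * exp (- pi * nu * s\<^sup>2)"
proof
  define r where "r = norm v * R"
  \<comment> \<open>For fixed \<open>e\<close> the maximum of
    \<open>nu * (x + e)\<^sup>2 - lam * x\<^sup>2\<close> over \<open>x\<close> is
    \<open>nu * lam / (lam - nu) * e\<^sup>2\<close>, found by completing the square.\<close>
  define C where "C = nu * lam / (lam - nu) * r\<^sup>2"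
  fix s :: real and w :: "(real^'n) \<times> (real^'n)" assume w: "v \<bullet> fst w = s"
  define E where "E = c * exp (pi * C) * exp (- pi * nu * s\<^sup>2)"
  have E: "E \<ge> 0" using \<open>0 \<le> c\<close> by (simp add: E_def)
  have sq: "nu * s\<^sup>2 \<le> lam * x\<^sup>2 + C" if "\<bar>x - s\<bar> \<le> r" for x
  proof -
    define e where "e = s - x"
    have "0 \<le> ((lam - nu) * x - nu * e)\<^sup>2 / (lam - nu)" using \<open>nu < lam\<close> by simp
    also have "\<dots> = lam * x\<^sup>2 + nu * lam / (lam - nu) * e\<^sup>2 - nu * (x + e)\<^sup>2"
      using \<open>nu < lam\<close> by (simp add: field_simps power2_eq_square)
    finally have "nu * s\<^sup>2 \<le> lam * x\<^sup>2 + nu * lam / (lam - nu) * e\<^sup>2" by (simp add: e_def)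
    moreover have "nu * lam / (lam - nu) * e\<^sup>2 \<le> C"
      unfolding C_def using that \<open>0 < nu\<close> \<open>nu < lam\<close>
      by (intro mult_left_mono) (auto simp: e_def abs_le_square_iff[symmetric] abs_minus_commute)
    ultimately show ?thesis by simp
  qed
  have shift: "integrable lebesgue (\<lambda>y. h (y - fst w))" "(\<lambda>y. h (y - fst w)) \<in> L2"
    "integral\<^sup>L lebesgue (\<lambda>y. cmod (h (y - fst w))) = integral\<^sup>L lebesgue (\<lambda>y. cmod (h y))"
    using integrable_lebesgue_affine_iff[of h 1 "- fst w"] h L2_measurable[OF h(1)]
      L2_affine[OF h(1), of 1 "- fst w"] integral_lebesgue_affine[of "\<lambda>y. cmod (h y)" 1 "- fst w"]
    by simp_all
  have nps: "cmod (phase_shift w h y) = cmod (h (y - fst w))" for y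
    by (simp add: phase_shift_def norm_mult)
  have ps: "phase_shift w h \<in> L2"
    unfolding phase_shift_def using shift(2)
    by (intro L2_cmult_bounded[where K=1]) (auto intro: measurable_lebesgue_character)
  have "cmod (integral\<^sup>L lebesgue (\<lambda>y. f y * cnj (phase_shift w h y))) \<le>
      integral\<^sup>L lebesgue (\<lambda>y. cmod (f y * cnj (phase_shift w h y)))"
    by (rule integral_norm_bound)
  also have "\<dots> \<le> integral\<^sup>L lebesgue (\<lambda>y. E * cmod (h (y - fst w)))"
  proof (rule integral_mono_AE)
    show "integrable lebesgue (\<lambda>y. cmod (f y * cnj (phase_shift w h y)))"
      using f ps by (intro integrable_norm L2_mult_integrable L2_cnj)
    show "integrable lebesgue (\<lambda>y. E * cmod (h (y - fst w)))" using shift by simp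
    show "AE y in lebesgue. cmod (f y * cnj (phase_shift w h y)) \<le> E * cmod (h (y - fst w))"
      using bd
    proof eventually_elim
      case (elim y)
      show ?case
      proof (cases "norm (y - fst w) < R")
        case True
        have "\<bar>v \<bullet> y - s\<bar> = \<bar>v \<bullet> (y - fst w)\<bar>" by (simp add: inner_diff_right w)
        also have "\<dots> \<le> norm v * norm (y - fst w)" by (rule Cauchy_Schwarz_ineq2)
        also have "\<dots> \<le> r" unfolding r_def using True by (intro mult_left_mono) auto
        finally have "pi * (nu * s\<^sup>2) \<le> pi * (lam * (v \<bullet> y)\<^sup>2 + C)"
          using sq pi_ge_zero by (intro mult_left_mono) auto
        then have "exp (- pi * lam * (v \<bullet> y)\<^sup>2) \<le> exp (pi * C) * exp (- pi * nu * s\<^sup>2)"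
          by (simp add: algebra_simps flip: exp_add)
        then have "c * exp (- pi * lam * (v \<bullet> y)\<^sup>2) \<le> E"
          using \<open>0 \<le> c\<close> by (simp add: E_def mult.assoc mult_left_mono)
        with elim show ?thesis by (simp add: norm_mult nps mult_right_mono)
      next
        case False
        then show ?thesis by (simp add: norm_mult nps supp)
      qed
    qed
  qed
  also have "\<dots> = E * integral\<^sup>L lebesgue (\<lambda>y. cmod (h y))" by (simp add: shift(3))
  finally show "cmod (integral\<^sup>L lebesgue (\<lambda>y. f y * cnj (phase_shift w h y))) \<le>
      (c * exp (pi * (nu * lam / (lam - nu) * (norm v * R)\<^sup>2)) * integral\<^sup>L lebesgue (\<lambda>y. cmod (h y))) * exp (- pi * nu * s\<^sup>2)"
    by (simp add: E_def C_def r_def mult_ac)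
qed

text \<open>The decay of \<open>a\<close> is split: the share \<open>1 / mu\<close> of the form of
  \<open>N\<close> pays for the exponential in \<open>\<eta> \<bullet> y\<close>, and the rest
  together with \<open>q\<close> leaves a Gaussian in all directions.\<close>

lemma Gaussian_weight_exponential_integral:
  fixes a b \<Phi> :: "real^'n \<Rightarrow> complex" and q :: "real^'n \<Rightarrow> real"
  assumes a: "a \<in> L2" and b: "b \<in> L2"
    and bd: "AE y in lebesgue. cmod (a y) \<le> c * exp (- pi * ((N *v y) \<bullet> y))" and "0 \<le> c"
    and \<eta>: "\<And>y. (\<eta> \<bullet> y)\<^sup>2 \<le> (N *v y) \<bullet> y" and "1 < mu" and "0 < k"
    and Q: "\<And>y. k * (norm y)\<^sup>2 \<le> pi * (1 - 1 / mu) * ((N *v y) \<bullet> y) + q y"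
    and q: "q \<in> borel_measurable lebesgue"
    and \<Phi>_def: "\<Phi> = (\<lambda>y. of_real (exp (- q y)) * (a y * cnj (b y)))"
  shows "integrable lebesgue (\<lambda>y. exp (r * \<bar>\<eta> \<bullet> y\<bar>) * cmod (\<Phi> y))"
    and "\<exists>K. \<forall>z. cmod (integral\<^sup>L lebesgue (\<lambda>y. exp (z * of_real (\<eta> \<bullet> y)) * \<Phi> y)) \<le>
           K * exp (mu * (Re z)\<^sup>2 / (4 * pi))"
proof -
  note [measurable] = a[THEN L2_measurable] b[THEN L2_measurable] q
  have [measurable]: "\<Phi> \<in> borel_measurable lebesgue" unfolding \<Phi>_def by measurable
  \<comment> \<open>The leftover Gaussian is square-integrable, so its product with \<open>b\<close>
    is an integrable majorant.\<close>
  define g where "g = (\<lambda>y::real^'n. complex_of_real (exp (- k * (norm y)\<^sup>2)))"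
  have g: "g \<in> L2"
  proof (rule L2_I)
    have "g \<in> borel_measurable borel" unfolding g_def by measurable
    then show "g \<in> borel_measurable lebesgue" by (simp add: measurable_completion)
    have "(cmod (g y))\<^sup>2 = exp (- (2 * k) * (norm y)\<^sup>2)" for y
      by (simp add: g_def power2_eq_square flip: exp_add)
    then show "integrable lebesgue (\<lambda>y. (cmod (g y))\<^sup>2)"
      using integrable_lebesgue_Gaussian[of "2 * k"] \<open>0 < k\<close> by simp
  qed
  have gb: "integrable lebesgue (\<lambda>y. cmod (g y * b y))"
    using g b by (intro integrable_norm L2_mult_integrable)
  have AE: "AE y in lebesgue. exp (r * \<bar>\<eta> \<bullet> y\<bar>) * cmod (\<Phi> y) \<le>
      c * exp (mu * r\<^sup>2 / (4 * pi)) * cmod (g y * b y)" for r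
    using bd
  proof eventually_elim
    case (elim y)
    define n e where "n = (N *v y) \<bullet> y" and "e = \<bar>\<eta> \<bullet> y\<bar>"
    have en: "e\<^sup>2 \<le> n" using \<eta>[of y] by (simp add: e_def n_def)
    \<comment> \<open>Completing the square bounds \<open>r * e\<close> by
      \<open>mu * r\<^sup>2 / (4 * pi) + pi * e\<^sup>2 / mu\<close>; the first term becomes the
      growth rate.\<close>
    have "0 \<le> (mu * r / (2 * pi) - e)\<^sup>2 * (pi / mu)" using \<open>1 < mu\<close> by simp
    also have "\<dots> = mu * r\<^sup>2 / (4 * pi) - r * e + pi * e\<^sup>2 / mu"
      using \<open>1 < mu\<close> by (simp add: field_simps power2_eq_square)
    also have "pi * e\<^sup>2 / mu \<le> pi * n / mu" using en \<open>1 < mu\<close> by (intro divide_right_mono mult_left_mono) auto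
    finally have re: "r * e \<le> mu * r\<^sup>2 / (4 * pi) + pi * n / mu" by simp
    have "k * (norm y)\<^sup>2 \<le> pi * n - pi * n / mu + q y"
      using Q[of y] by (simp add: n_def algebra_simps)
    with re have ex: "r * e - pi * n - q y \<le> mu * r\<^sup>2 / (4 * pi) - k * (norm y)\<^sup>2" by simp
    have "exp (r * e) * cmod (\<Phi> y) = exp (r * e) * exp (- q y) * cmod (b y) * cmod (a y)"
      by (simp add: \<Phi>_def norm_mult)
    also have "\<dots> \<le> exp (r * e) * exp (- q y) * cmod (b y) * (c * exp (- pi * n))"
      using elim by (intro mult_left_mono) (auto simp: n_def)
    also have "\<dots> = c * cmod (b y) * exp (r * e - pi * n - q y)"
      by (simp add: exp_diff exp_minus exp_add field_simps)
    also have "\<dots> \<le> c * cmod (b y) * exp (mu * r\<^sup>2 / (4 * pi) - k * (norm y)\<^sup>2)"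
      using ex \<open>0 \<le> c\<close> by (intro mult_left_mono) auto
    also have "\<dots> = c * exp (mu * r\<^sup>2 / (4 * pi)) * (exp (- k * (norm y)\<^sup>2) * cmod (b y))"
    proof -
      have "exp (mu * r\<^sup>2 / (4 * pi) - k * (norm y)\<^sup>2) =
          exp (mu * r\<^sup>2 / (4 * pi)) * exp (- k * (norm y)\<^sup>2)"
        by (simp flip: exp_add)
      then show ?thesis by (simp only: mult.assoc mult.commute mult.left_commute)
    qed
    also have "\<dots> = c * exp (mu * r\<^sup>2 / (4 * pi)) * cmod (g y * b y)"
      by (simp add: g_def norm_mult)
    finally show ?case by (simp add: e_def)
  qed
  show int: "integrable lebesgue (\<lambda>y. exp (r * \<bar>\<eta> \<bullet> y\<bar>) * cmod (\<Phi> y))" for r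
  proof (rule Bochner_Integration.integrable_bound)
    show "integrable lebesgue (\<lambda>y. c * exp (mu * r\<^sup>2 / (4 * pi)) * cmod (g y * b y))"
      using gb by simp
    show "AE y in lebesgue. norm (exp (r * \<bar>\<eta> \<bullet> y\<bar>) * cmod (\<Phi> y)) \<le>
        norm (c * exp (mu * r\<^sup>2 / (4 * pi)) * cmod (g y * b y))"
      using AE[of r] \<open>0 \<le> c\<close> by (auto simp: abs_mult elim!: eventually_mono)
  qed measurable
  have "cmod (integral\<^sup>L lebesgue (\<lambda>y. exp (z * of_real (\<eta> \<bullet> y)) * \<Phi> y)) \<le>
      c * integral\<^sup>L lebesgue (\<lambda>y. cmod (g y * b y)) * exp (mu * (Re z)\<^sup>2 / (4 * pi))" for z
  proof -
    have le: "cmod (exp (z * of_real (\<eta> \<bullet> y)) * \<Phi> y) \<le> exp (\<bar>Re z\<bar> * \<bar>\<eta> \<bullet> y\<bar>) * cmod (\<Phi> y)" for y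
    proof -
      have "Re z * (\<eta> \<bullet> y) \<le> \<bar>Re z\<bar> * \<bar>\<eta> \<bullet> y\<bar>" by (metis abs_ge_self abs_mult)
      then show ?thesis by (simp add: norm_mult mult_right_mono)
    qed
    have "cmod (integral\<^sup>L lebesgue (\<lambda>y. exp (z * of_real (\<eta> \<bullet> y)) * \<Phi> y)) \<le>
        integral\<^sup>L lebesgue (\<lambda>y. cmod (exp (z * of_real (\<eta> \<bullet> y)) * \<Phi> y))"
      by (rule integral_norm_bound)
    also have "\<dots> \<le> integral\<^sup>L lebesgue (\<lambda>y. exp (\<bar>Re z\<bar> * \<bar>\<eta> \<bullet> y\<bar>) * cmod (\<Phi> y))"
      using le by (intro integral_mono' int) auto
    also have "\<dots> \<le> integral\<^sup>L lebesgue (\<lambda>y. c * exp (mu * \<bar>Re z\<bar>\<^sup>2 / (4 * pi)) * cmod (g y * b y))"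
      using gb by (intro integral_mono_AE int AE) simp
    finally show ?thesis by (simp add: mult_ac)
  qed
  then show "\<exists>K. \<forall>z. cmod (integral\<^sup>L lebesgue (\<lambda>y. exp (z * of_real (\<eta> \<bullet> y)) * \<Phi> y)) \<le>
      K * exp (mu * (Re z)\<^sup>2 / (4 * pi))" by blast
qed

text \<open>The weight makes the exponential integral entire, and the two Gaussian bounds on it
  force it to vanish; its value at 0 is the integral in question.\<close>

lemma Gaussian_weighted_coefficient_zero:
  fixes a b :: "real^'n \<Rightarrow> complex"
  assumes a: "a \<in> L2" and b: "b \<in> L2"
    and bd: "AE y in lebesgue. cmod (a y) \<le> c * exp (- pi * ((N *v y) \<bullet> y))" and "0 \<le> c"
    and N: "psd_sym N" and \<eta>: "\<And>y. (\<eta> \<bullet> y)\<^sup>2 \<le> (N *v y) \<bullet> y" and "1 < nu"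
    and V: "subspace V" and X: "finite X" "X \<subseteq> V"
    and ker: "\<And>y. N *v y = 0 \<Longrightarrow> (\<And>x. x \<in> X \<Longrightarrow> x \<bullet> y = 0) \<Longrightarrow> y = 0"
    and decay: "\<And>s w. w \<in> V \<Longrightarrow>
      cmod (integral\<^sup>L lebesgue (\<lambda>y. character (s *\<^sub>R \<eta> + w) y * (a y * cnj (b y)))) \<le> K * exp (- pi * nu * s\<^sup>2)"
  shows "integral\<^sup>L lebesgue (\<lambda>y. of_real (exp (- (\<Sum>x\<in>X. (x \<bullet> y)\<^sup>2) / 2)) * (a y * cnj (b y))) = 0"
proof -
  obtain mu where mu: "1 < mu" "mu < nu" using \<open>1 < nu\<close> dense by blast
  define q where "q = (\<lambda>y. (\<Sum>x\<in>X. (x \<bullet> y)\<^sup>2) / 2)"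
  have qm: "q \<in> borel_measurable lebesgue" unfolding q_def by measurable
  define \<Phi> where "\<Phi> = (\<lambda>y. of_real (exp (- q y)) * (a y * cnj (b y)))"
  have [measurable]: "\<Phi> \<in> borel_measurable lebesgue"
    using L2_measurable[OF a] L2_measurable[OF b] qm unfolding \<Phi>_def by measurable
  \<comment> \<open>The form left after spending the share \<open>1 / mu\<close>. It is positive
    definite because the kernel of \<open>N\<close> meets the orthogonal complement of
    \<open>X\<close> only in 0.\<close>
  define Q where "Q = (\<lambda>y. pi * (1 - 1 / mu) * ((N *v y) \<bullet> y) + q y)"
  have nonneg: "0 \<le> (N *v y) \<bullet> y" "0 \<le> q y" for y
    using N by (auto simp: psd_sym_def q_def intro: sum_nonneg)
  obtain k where k: "k > 0" "\<And>y. k * (norm y)\<^sup>2 \<le> Q y"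
  proof (rule positive_form_lower_bound[of Q])
    show "continuous_on UNIV Q" unfolding Q_def q_def
      by (intro continuous_intros matrix_vector_mult_linear_continuous_on) auto
    show "Q (r *\<^sub>R y) = r\<^sup>2 * Q y" for r y
      by (simp add: Q_def q_def matrix_vector_mult_scaleR power_mult_distrib sum_distrib_left
          ring_distribs power2_eq_square mult_ac)
    show "Q y > 0" if "y \<noteq> 0" for y
    proof (rule ccontr)
      assume "\<not> Q y > 0"
      moreover have p: "pi * (1 - 1 / mu) > 0" using mu by simp
      then have "0 \<le> pi * (1 - 1 / mu) * ((N *v y) \<bullet> y)" by (intro mult_nonneg_nonneg less_imp_le[OF p] nonneg(1))
      ultimately have "pi * (1 - 1 / mu) * ((N *v y) \<bullet> y) = 0" and q0: "q y = 0"
        using nonneg(2)[of y] unfolding Q_def by linarith+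
      then have "(N *v y) \<bullet> y = 0" using p by (metis mult_eq_0_iff less_irrefl)
      then have "N *v y = 0" by (rule psd_sym_inner_self_eq_0[OF N])
      moreover have "\<forall>x\<in>X. x \<bullet> y = 0" using q0 X(1) by (simp add: q_def sum_nonneg_eq_0_iff)
      ultimately show False using ker that by blast
    qed
  qed (rule that)
  define H where "H = (\<lambda>z. integral\<^sup>L lebesgue (\<lambda>y. exp (z * of_real (\<eta> \<bullet> y)) * \<Phi> y))"
  note exp_int = Gaussian_weight_exponential_integral[OF a b bd \<open>0 \<le> c\<close> \<eta> mu(1) k(1) k(2)[unfolded Q_def] qm \<Phi>_def]
  obtain K' where K': "\<And>z. cmod (H z) \<le> K' * exp (mu * (Re z)\<^sup>2 / (4 * pi))"
    using exp_int(2) unfolding H_def by blast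
  have "H holomorphic_on UNIV"
    unfolding H_def by (rule entire_exponential_integral) (measurable, rule exp_int(1))
  \<comment> \<open>The factor \<open>2 * pi * \<i>\<close> turns real arguments into characters and
    the rate \<open>mu / (4 * pi)\<close> in the real part into \<open>pi * mu\<close> in the
    imaginary part.\<close>
  then have hol: "(\<lambda>z. H (2 * of_real pi * \<i> * z)) holomorphic_on UNIV"
    using holomorphic_on_compose_gen[of "\<lambda>z. 2 * of_real pi * \<i> * z" UNIV H UNIV]
    by (simp add: o_def holomorphic_intros)
  have real: "H (2 * of_real pi * \<i> * of_real s) = integral\<^sup>L lebesgue (\<lambda>y. character (s *\<^sub>R \<eta> + 0) y * \<Phi> y)" for s
    by (simp add: H_def mult.assoc)
  have "H (2 * of_real pi * \<i> * 0) = 0"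
  proof (rule entire_Gaussian_bounds_imp_zero[where mu=mu and nu=nu and K="max K K'", OF hol])
    show "cmod (H (2 * of_real pi * \<i> * z)) \<le> max K K' * exp (pi * mu * (Im z)\<^sup>2)" for z
    proof -
      have "cmod (H (2 * of_real pi * \<i> * z)) \<le> K' * exp (pi * mu * (Im z)\<^sup>2)"
        using K'[of "2 * of_real pi * \<i> * z"] by (simp add: power2_eq_square field_simps)
      also have "\<dots> \<le> max K K' * exp (pi * mu * (Im z)\<^sup>2)" by (intro mult_right_mono) auto
      finally show ?thesis .
    qed
    show "cmod (H (2 * of_real pi * \<i> * of_real s)) \<le> max K K' * exp (- pi * nu * s\<^sup>2)" for s
    proof -
      \<comment> \<open>The weight costs nothing here, because the assumed decay is uniform in
        \<open>w\<close> over \<open>V\<close>.\<close>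
      have "cmod (H (2 * of_real pi * \<i> * of_real s)) \<le> K * exp (- pi * nu * s\<^sup>2)"
        unfolding real \<Phi>_def q_def minus_divide_left
        by (rule Gaussian_product_multiplier_bound(2)[OF X V]) 
          (use decay a b V in \<open>auto intro: L2_mult_integrable L2_cnj subspace_0\<close>)
      also have "\<dots> \<le> max K K' * exp (- pi * nu * s\<^sup>2)" by (intro mult_right_mono) auto
      finally show ?thesis .
    qed
  qed (use mu in auto)
  then show ?thesis by (simp add: H_def \<Phi>_def q_def)
qed

theorem theorem1p5:
  fixes A B C D M N :: "real^'n^'n"
    and U :: "(real^'n \<Rightarrow> complex) \<Rightarrow> (real^'n \<Rightarrow> complex)"
    and f :: "real^'n \<Rightarrow> complex"
    and c :: real
  assumes "Jblocks_symplectic A B C D"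
    and "B \<noteq> 0"
    and "metaplectic A B C D U"
    and "psd_sym M" and "psd_sym N"
    and "{x. M *v x = 0} = {x. B *v x = 0}"
    and "range (\<lambda>x. N *v x) = range (\<lambda>x. B *v x)"
    and "f \<in> L2"
    and "c > 0"
    and "AE x in lebesgue. cmod (f x) \<le> c * exp (- pi * ((M *v x) \<bullet> x))"
    and "AE \<xi> in lebesgue. cmod (U f \<xi>) \<le> c * exp (- pi * ((N *v \<xi>) \<bullet> \<xi>))"
    and "\<exists>lam v. lam > 1 \<and> v \<noteq> 0 \<and> (M ** transpose B ** N ** B) *v v = lam *\<^sub>R v"
  shows "AE x in lebesgue. f x = 0"
proof -
  note S = assms(1) and met = assms(3) and M = assms(4) and N = assms(5) and f = assms(8)
  obtain lam v0 where lam: "lam > 1" "v0 \<noteq> 0" "(M ** transpose B ** N ** B) *v v0 = lam *\<^sub>R v0"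
    using assms(12) by blast
  obtain v \<eta> where v: "v \<bullet> (transpose B *v \<eta>) = 1" "\<And>y. lam * (v \<bullet> y)\<^sup>2 \<le> (M *v y) \<bullet> y"
    and \<eta>: "\<And>y. (\<eta> \<bullet> y)\<^sup>2 \<le> (N *v y) \<bullet> y"
    using eigenvalue_rank_one_bounds[OF M N _ lam(2,3)] lam(1) by auto
  \<comment> \<open>The gap below \<open>lam\<close> pays for the cut-off to a ball, the gap above 1
    leaves room for \<open>mu\<close> in the growth bound.\<close>
  obtain nu where nu: "1 < nu" "nu < lam" using lam(1) dense by blast
  have fbd: "AE y in lebesgue. cmod (f y) \<le> c * exp (- pi * lam * (v \<bullet> y)\<^sup>2)"
    using assms(10)
  proof eventually_elim
    case (elim y)
    have "c * exp (- pi * ((M *v y) \<bullet> y)) \<le> c * exp (- pi * lam * (v \<bullet> y)\<^sup>2)"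
      using v(2)[of y] assms(9) by (simp add: mult.assoc)
    with elim show ?case by linarith
  qed
  have UL2: "\<And>f. f \<in> L2 \<Longrightarrow> U f \<in> L2" and
    iso: "\<And>f g. f \<in> L2 \<Longrightarrow> g \<in> L2 \<Longrightarrow>
        integral\<^sup>L lebesgue (\<lambda>x. U f x * cnj (U g x)) = integral\<^sup>L lebesgue (\<lambda>x. f x * cnj (g x))"
    using met by (auto simp: metaplectic_def unitary_L2_def)
  define V where "V = (\<lambda>\<xi>. D *v \<xi>) ` {\<xi>. B *v \<xi> = 0}"
  have V: "subspace V"
    unfolding V_def
    by (intro linear_subspace_image matrix_vector_mul_linear)
      (auto simp: subspace_def matrix_vector_right_distrib matrix_vector_mult_scaleR)
  \<comment> \<open>A finite spanning set, so that the squares of its inner products form a weight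
    vanishing only on the orthogonal complement of \<open>V\<close>.\<close>
  obtain X0 where X0: "X0 \<subseteq> V" "finite X0" "span X0 = V"
    using basis_subspace_exists[OF V] by (metis finiteI_independent)
  have BV: "transpose B *v w = 0" if w: "w \<in> V" for w
  proof -
    obtain \<xi> where \<xi>: "w = D *v \<xi>" "B *v \<xi> = 0" using w by (auto simp: V_def)
    have "transpose B *v (D *v \<xi>) = transpose D *v (B *v \<xi>)"
      using S by (simp add: Jblocks_symplectic_def matrix_vector_mul_assoc del: transpose_matrix_vector)
    then show ?thesis by (simp add: \<xi> del: transpose_matrix_vector)
  qed
  have ker: "y = 0" if y: "N *v y = 0" "\<And>x. x \<in> X0 \<Longrightarrow> x \<bullet> y = 0" for y
  proof (rule symplectic_joint_kernel_trivial[OF S N assms(7) y(1)])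
    fix \<xi> assume "B *v \<xi> = 0"
    then have "D *v \<xi> \<in> span X0" unfolding X0(3) by (auto simp: V_def)
    moreover have "span X0 \<subseteq> {x. x \<bullet> y = 0}"
    proof (rule span_minimal)
      show "subspace {x. x \<bullet> y = 0}" by (auto simp: subspace_def inner_add_left)
    qed (use y(2) in auto)
    ultimately show "(D *v \<xi>) \<bullet> y = 0" by blast
  qed
  have ball: "AE y in lebesgue. y \<in> ball 0 (real n) \<longrightarrow> f y = 0" for n
  proof -
    define i where "i = (\<lambda>y::real^'n. indicator (ball 0 (real n)) y :: complex)"
    have i: "i \<in> L2"
    proof (rule L2_I)
      show "i \<in> borel_measurable lebesgue" unfolding i_def by (intro borel_measurable_indicator) simp
      have "(cmod (i y))\<^sup>2 = indicator (ball 0 (real n)) y" for y by (simp add: i_def indicator_def)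
      then show "integrable lebesgue (\<lambda>y. (cmod (i y))\<^sup>2)"
        using lmeasurable_ball[of 0 "real n"]
        by (simp only:) (intro integrable_real_indicator, auto simp: fmeasurable_def)
    qed
    define h where "h = (\<lambda>y. f y * i y)"
    have h: "h \<in> L2" unfolding h_def
      by (rule L2_cmult_bounded[OF f L2_measurable[OF i], of 1]) (simp add: i_def indicator_def)
    have hint: "integrable lebesgue h" unfolding h_def using f i by (rule L2_mult_integrable)
    have h0: "h y = 0" if "norm y \<ge> real n" for y using that by (simp add: h_def i_def)
    have "0 < nu" "0 \<le> c" using nu assms(9) by auto
    from shifted_coefficient_decay[where R="real n" and nu=nu, OF f h hint fbd h0 this(1) nu(2) this(2)]
    obtain K where K: "\<And>s w. v \<bullet> fst w = s \<Longrightarrow>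
        cmod (integral\<^sup>L lebesgue (\<lambda>y. f y * cnj (phase_shift w h y))) \<le> K * exp (- pi * nu * s\<^sup>2)"
      by metis
    \<comment> \<open>A frequency \<open>w\<close> in \<open>V\<close> does not change the position
      shift, which remains \<open>s *\<^sub>R (transpose B *v \<eta>)\<close>; its inner product
      with \<open>v\<close> is \<open>s\<close> by the normalisation.\<close>
    have decay: "cmod (integral\<^sup>L lebesgue (\<lambda>y. character (s *\<^sub>R \<eta> + w) y * (U f y * cnj (U h y))))
        \<le> K * exp (- pi * nu * s\<^sup>2)" if "w \<in> V" for s w
    proof -
      have "transpose B *v (s *\<^sub>R \<eta> + w) = s *\<^sub>R (transpose B *v \<eta>)"
        using BV[OF that] by (simp add: matrix_vector_right_distrib matrix_vector_mult_scaleR del: transpose_matrix_vector)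
      then show ?thesis
        unfolding modulated_coefficient_eq[OF S met f h]
        by (intro K) (simp add: v(1) del: transpose_matrix_vector)
    qed
    define \<Psi> where "\<Psi> = (\<lambda>y. U f y * cnj (U h y))"
    have \<Psi>: "integrable lebesgue \<Psi>"
      unfolding \<Psi>_def using f h by (intro L2_mult_integrable L2_cnj UL2)
    note [measurable] = borel_measurable_integrable[OF \<Psi>]
    define q where "q = (\<lambda>y. (\<Sum>x\<in>X0. (x \<bullet> y)\<^sup>2) / 2)"
    have q: "q \<in> borel_measurable lebesgue" "0 \<le> q y" for y
      unfolding q_def by (measurable, auto intro: sum_nonneg)
    note [measurable] = q(1)
    define e where "e = (\<lambda>m. 1 / real (Suc m))"
    \<comment> \<open>Rescaling \<open>X0\<close> by \<open>e m\<close> preserves the kernel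
      condition and the inclusion in \<open>V\<close>, while the weight tends to 1 pointwise as
      \<open>m\<close> grows.\<close>
    have zero: "integral\<^sup>L lebesgue (\<lambda>y. of_real (exp (- ((e m)\<^sup>2 * q y))) * \<Psi> y) = 0" for m
    proof -
      have e: "e m \<noteq> 0" by (simp add: e_def)
      define X where "X = (\<lambda>x. e m *\<^sub>R x) ` X0"
      have "integral\<^sup>L lebesgue (\<lambda>y. of_real (exp (- (\<Sum>x\<in>X. (x \<bullet> y)\<^sup>2) / 2)) * (U f y * cnj (U h y))) = 0"
      proof (rule Gaussian_weighted_coefficient_zero[OF UL2[OF f] UL2[OF h] assms(11) _ N \<eta> nu(1) V _ _ _ decay])
        show "finite X" "X \<subseteq> V" using X0 V by (auto simp: X_def subspace_scale)
        show "y = 0" if "N *v y = 0" "\<And>x. x \<in> X \<Longrightarrow> x \<bullet> y = 0" for y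
        proof (rule ker[OF that(1)])
          fix x assume "x \<in> X0"
          then have "(e m *\<^sub>R x) \<bullet> y = 0" by (intro that(2)) (auto simp: X_def)
          then show "x \<bullet> y = 0" using e by simp
        qed
      qed (use assms(9) in auto)
      moreover have "(\<Sum>x\<in>X. (x \<bullet> y)\<^sup>2) = (e m)\<^sup>2 * (\<Sum>x\<in>X0. (x \<bullet> y)\<^sup>2)" for y
        unfolding X_def using e
        by (subst sum.reindex) (auto simp: inj_on_def power_mult_distrib sum_distrib_left)
      ultimately show ?thesis by (simp add: \<Psi>_def q_def)
    qed
    have e0: "e \<longlonglongrightarrow> 0" unfolding e_def using LIMSEQ_Suc[OF lim_1_over_n] by simp
    have "(\<lambda>m. integral\<^sup>L lebesgue (\<lambda>y. of_real (exp (- ((e m)\<^sup>2 * q y))) * \<Psi> y)) \<longlonglongrightarrow> integral\<^sup>L lebesgue \<Psi>"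
    proof (rule integral_dominated_convergence[where w="\<lambda>y. cmod (\<Psi> y)"])
      have "(\<lambda>m. of_real (exp (- ((e m)\<^sup>2 * q y))) * \<Psi> y) \<longlonglongrightarrow> of_real (exp (- (0\<^sup>2 * q y))) * \<Psi> y" for y
        by (intro tendsto_intros e0)
      then show "AE y in lebesgue. (\<lambda>m. of_real (exp (- ((e m)\<^sup>2 * q y))) * \<Psi> y) \<longlonglongrightarrow> \<Psi> y" by simp
      show "AE y in lebesgue. norm (of_real (exp (- ((e m)\<^sup>2 * q y))) * \<Psi> y) \<le> cmod (\<Psi> y)" for m
        using q(2) by (intro AE_I2) (simp add: norm_mult mult_left_le_one_le)
    qed (use \<Psi> in auto)
    then have "integral\<^sup>L lebesgue \<Psi> = 0"
      by (simp add: zero LIMSEQ_const_iff)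
    \<comment> \<open>The isometry property returns to \<open>f\<close>; as \<open>h\<close> is a
      restriction of \<open>f\<close>, this inner product is the squared norm of
      \<open>h\<close>.\<close>
    then have "integral\<^sup>L lebesgue (\<lambda>y. f y * cnj (h y)) = 0"
      using iso[OF f h] by (simp add: \<Psi>_def)
    moreover have "f y * cnj (h y) = of_real ((cmod (h y))\<^sup>2)" for y
      using complex_norm_square[of "f y"] by (simp add: h_def i_def indicator_def)
    ultimately have "integral\<^sup>L lebesgue (\<lambda>y. (cmod (h y))\<^sup>2) = 0"
      by (simp only: integral_complex_of_real) simp
    then have "AE y in lebesgue. (cmod (h y))\<^sup>2 = 0"
      using L2_norm_integrable[OF h] by (subst (asm) integral_nonneg_eq_0_iff_AE) auto
    then show ?thesis by eventually_elim (auto simp: h_def i_def indicator_def split: if_splits)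
  qed
  have "AE y in lebesgue. \<forall>n. y \<in> ball 0 (real n) \<longrightarrow> f y = 0"
    unfolding AE_all_countable using ball by blast
  then show ?thesis
  proof eventually_elim
    case (elim y)
    obtain n where "norm y < real n" using reals_Archimedean2 by blast
    then show ?case using elim by auto
  qed
qed

end
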